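(* Let $n\ge2$, and let $\Gamma\subset\mathbb{R}^n$ be a non-degenerate curve (of uniform finite type $(1,\ldots,n)$). Then $\Gamma$ is uniformly profile-regular, with $$\rho_\Gamma(a)=\max_{1\le i\le n}\frac{a_i}{i},\qquad a\in\mathcal K_n.$$ Its lower and upper prints are $$\underline{\mathrm P}(\Gamma)=\Bigl\{\alpha\in[0,\infty)^n:\ \sum_{i=1}^n i\alpha_i\le1\Bigr\}$$ and $$\overline{\mathrm P}(\Gamma)=\{\alpha\in[0,\infty)^n:S_1(\alpha)\le1\}\cup\bigcup_{k=2}^n\Bigl\{\alpha\in[0,\infty)^n:S_k(\alpha)<\frac1k\Bigr\}.$$
   Context: Non-degenerate curve: let $\Gamma\subset\mathbb{R}^n$ be a non-empty compact embedded $C^{n+1}$ curve, possibly with boundary and not necessarily connected. At boundary points, local parametrisations are understood to have $C^{n+1}$ extensions to open intervals. $\Gamma$ is called non-degenerate, or of uniform finite type $(1,\ldots,n)$, if every local unit-speed parametrisation $\gamma$ satisfies $\det(\gamma'(s),\ldots,\gamma^{(n)}(s))\ne0$ at every parameter $s$ corresponding to a point of $\Gamma$. $S_k(\alpha)=\sum_{i=k}^n\alpha_i$. An open box in $\mathbb{R}^n$ is an open rectangular box with positive side lengths and arbitrary orientation; its side lengths in decreasing order are $l_1(B)\ge\cdots\ge l_n(B)>0$. Let $\Delta_n=\{\delta\in(0,1)^n:\delta_1\ge\cdots\ge\delta_n\}$. For non-empty bounded $F\subset\mathbb{R}^n$ and $\delta\in\Delta_n$, $N(F;\delta)$ is the least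 number of open boxes $B$ needed to cover $F$, subject to $l_i(B)\le\delta_i$ for $1\le i\le n$ for every box in the cover (boxes may have different orientations). For $\alpha\in[0,\infty)^n$ write $\delta^\alpha=\prod_i\delta_i^{\alpha_i}$. The lower and upper box dimension prints are $$\underline{\mathrm P}(F)=\Bigl\{\alpha\in[0,\infty)^n:\liminf_{\delta\in\Delta_n,\,\delta_1\downarrow0}N(F;\delta)\delta^\alpha>0\Bigr\},\quad \overline{\mathrm P}(F)=\Bigl\{\alpha\in[0,\infty)^n:\limsup_{\delta\in\Delta_n,\,\delta_1\downarrow0}N(F;\delta)\delta^\alpha>0\Bigr\},$$ the limits being over all of $\Delta_n$ as $\delta_1\downarrow0$. Let $\mathcal K_n=\{a\in(0,\infty)^n:a_1\le\cdots\le a_n\}$ and $\mathcal C_n=\{a\in\mathcal K_n:a_1=1\}$. For $a\in\mathcal K_n$, $t>0$ let $e^{-ta}=(e^{-ta_1},\dots,e^{-ta_n})$. The profile of $F$ exists if for every $a\in\mathcal K_n$ the limit $\rho_F(a)=\lim_{t\to\infty}\frac1t\log N(F;e^{-ta})$ exists. $F$ is uniformly profile-regular if its profile exists and there are $C\ge1$ and $t_0>0$ such that $C^{-1}e^{t\rho_F(a)}\le N(F;e^{-ta})\le Ce^{t\rho_F(a)}$ for all $a\in\mathcal C_n$, $t\ge t_0$. *)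

theory Defs
  imports "HOL-Analysis.Analysis"
begin

(* Conventions.  The ambient space is real ^ 'n, so n = CARD('n).  The exponent tuples delta,
   alpha, a are elements of R^n written as extensional functions on {1..n}, which keeps the
   indices 1, ..., n (and hence their order and their numerical values) explicit. *)

(* A fixed enumeration of the coordinates of real ^ 'n.  Nothing below depends on the choice:
   it changes the determinant only by a sign, and permutations of the coordinates are
   orthogonal maps. *)
definition idx :: "'n::finite \<Rightarrow> nat" where
  "idx = (SOME e. bij_betw e UNIV {1..CARD('n)})"

lemma bij_betw_idx: "bij_betw (idx :: 'n::finite \<Rightarrow> nat) UNIV {1..CARD('n)}"
proof -
  have "\<exists>e :: 'n \<Rightarrow> nat. bij_betw e UNIV {1..CARD('n)}"
    by (rule finite_same_card_bij) auto
  then show ?thesis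
    unfolding idx_def by (rule someI_ex)
qed

subsection \<open>Non-degenerate curves\<close>

definition iter_vderiv :: "nat \<Rightarrow> (real \<Rightarrow> 'a::real_normed_vector) \<Rightarrow> real \<Rightarrow> 'a" where
  "iter_vderiv k \<gamma> = ((\<lambda>g s. vector_derivative g (at s)) ^^ k) \<gamma>"

(* Intended for open J only, where the two-sided derivatives are those of the restriction. *)
definition Ck_on :: "nat \<Rightarrow> (real \<Rightarrow> 'a::real_normed_vector) \<Rightarrow> real set \<Rightarrow> bool" where
  "Ck_on k \<gamma> J \<longleftrightarrow>
     (\<forall>j<k. \<forall>s\<in>J. iter_vderiv j \<gamma> differentiable (at s)) \<and> continuous_on J (iter_vderiv k \<gamma>)"

(* The parameter set I is any non-degenerate interval.  As the image is relatively open in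
   Gamma, end points belonging to I are exactly the parameters of boundary points.  There gamma
   denotes its C^k extension to the open interval J; by continuity its derivatives at points
   of I up to order k do not depend on the extension. *)
definition local_param ::
  "nat \<Rightarrow> (real ^ 'n) set \<Rightarrow> (real \<Rightarrow> real ^ 'n) \<Rightarrow> real set \<Rightarrow> bool" where
  "local_param k \<Gamma> \<gamma> I \<longleftrightarrow>
     is_interval I \<and> interior I \<noteq> {} \<and>
     openin (top_of_set \<Gamma>) (\<gamma> ` I) \<and>
     (\<exists>g. homeomorphism I (\<gamma> ` I) \<gamma> g) \<and>
     (\<exists>J. open J \<and> is_interval J \<and> I \<subseteq> J \<and> Ck_on k \<gamma> J) \<and>
     (\<forall>s\<in>I. vector_derivative \<gamma> (at s) \<noteq> 0)"

definition unit_speed_param ::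
  "nat \<Rightarrow> (real ^ 'n) set \<Rightarrow> (real \<Rightarrow> real ^ 'n) \<Rightarrow> real set \<Rightarrow> bool" where
  "unit_speed_param k \<Gamma> \<gamma> I \<longleftrightarrow>
     local_param k \<Gamma> \<gamma> I \<and> (\<forall>s\<in>I. norm (vector_derivative \<gamma> (at s)) = 1)"

definition compact_embedded_curve :: "nat \<Rightarrow> (real ^ 'n) set \<Rightarrow> bool" where
  "compact_embedded_curve k \<Gamma> \<longleftrightarrow>
     \<Gamma> \<noteq> {} \<and> compact \<Gamma> \<and> (\<forall>p\<in>\<Gamma>. \<exists>\<gamma> I. local_param k \<Gamma> \<gamma> I \<and> p \<in> \<gamma> ` I)"

definition nondegenerate_curve :: "(real ^ 'n) set \<Rightarrow> bool" where
  "nondegenerate_curve \<Gamma> \<longleftrightarrow>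
     compact_embedded_curve (CARD('n) + 1) \<Gamma> \<and>
     (\<forall>\<gamma> I. unit_speed_param (CARD('n) + 1) \<Gamma> \<gamma> I \<longrightarrow>
        (\<forall>s\<in>I. det ((\<chi> i j. iter_vderiv (idx j) \<gamma> s $ i) :: real ^ 'n ^ 'n) \<noteq> 0))"

subsection \<open>Covering numbers and box dimension prints\<close>

(* l i is the i-th side length of B in decreasing order. *)
definition open_box :: "(real ^ 'n) set \<Rightarrow> (nat \<Rightarrow> real) \<Rightarrow> bool" where
  "open_box B l \<longleftrightarrow>
     l \<in> {1..CARD('n)} \<rightarrow>\<^sub>E {0<..} \<and> antimono_on {1..CARD('n)} l \<and>
     (\<exists>(f :: real ^ 'n \<Rightarrow> real ^ 'n) c. orthogonal_transformation f \<and>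
        B = (\<lambda>x. c + f x) ` box 0 (\<chi> i. l (idx i)))"

definition covering_number :: "(real ^ 'n) set \<Rightarrow> (nat \<Rightarrow> real) \<Rightarrow> nat" where
  "covering_number F \<delta> =
     (LEAST m. \<exists>\<B>. finite \<B> \<and> card \<B> = m \<and> F \<subseteq> \<Union>\<B> \<and>
        (\<forall>B\<in>\<B>. \<exists>l. open_box B l \<and> (\<forall>i\<in>{1..CARD('n)}. l i \<le> \<delta> i)))"

definition Delta :: "nat \<Rightarrow> (nat \<Rightarrow> real) set" where
  "Delta n = {\<delta> \<in> {1..n} \<rightarrow>\<^sub>E {0<..<1}. antimono_on {1..n} \<delta>}"

definition exponents :: "nat \<Rightarrow> (nat \<Rightarrow> real) set" where
  "exponents n = {1..n} \<rightarrow>\<^sub>E {0..}"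

definition tuple_powr :: "nat \<Rightarrow> (nat \<Rightarrow> real) \<Rightarrow> (nat \<Rightarrow> real) \<Rightarrow> real" where
  "tuple_powr n \<delta> \<alpha> = (\<Prod>i\<in>{1..n}. \<delta> i powr \<alpha> i)"

(* delta ranges over all of Delta n while its first entry decreases to 0 *)
definition Delta_filter :: "nat \<Rightarrow> (nat \<Rightarrow> real) filter" where
  "Delta_filter n = inf (filtercomap (\<lambda>\<delta>. \<delta> 1) (at_right 0)) (principal (Delta n))"

definition lower_print :: "(real ^ 'n) set \<Rightarrow> (nat \<Rightarrow> real) set" where
  "lower_print F =
     {\<alpha> \<in> exponents CARD('n).
        Liminf (Delta_filter CARD('n))
          (\<lambda>\<delta>. ereal (real (covering_number F \<delta>) * tuple_powr CARD('n) \<delta> \<alpha>)) > 0}"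

definition upper_print :: "(real ^ 'n) set \<Rightarrow> (nat \<Rightarrow> real) set" where
  "upper_print F =
     {\<alpha> \<in> exponents CARD('n).
        Limsup (Delta_filter CARD('n))
          (\<lambda>\<delta>. ereal (real (covering_number F \<delta>) * tuple_powr CARD('n) \<delta> \<alpha>)) > 0}"

definition tail_sum :: "nat \<Rightarrow> nat \<Rightarrow> (nat \<Rightarrow> real) \<Rightarrow> real" where
  "tail_sum n k \<alpha> = (\<Sum>i=k..n. \<alpha> i)"

subsection \<open>Profiles\<close>

definition rates :: "nat \<Rightarrow> (nat \<Rightarrow> real) set" where
  "rates n = {a \<in> {1..n} \<rightarrow>\<^sub>E {0<..}. mono_on {1..n} a}"

definition normalized_rates :: "nat \<Rightarrow> (nat \<Rightarrow> real) set" where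
  "normalized_rates n = {a \<in> rates n. a 1 = 1}"

definition exp_scale :: "nat \<Rightarrow> (nat \<Rightarrow> real) \<Rightarrow> real \<Rightarrow> nat \<Rightarrow> real" where
  "exp_scale n a t = (\<lambda>i\<in>{1..n}. exp (- (t * a i)))"

definition log_growth :: "(real ^ 'n) set \<Rightarrow> (nat \<Rightarrow> real) \<Rightarrow> real \<Rightarrow> real" where
  "log_growth F a t = ln (real (covering_number F (exp_scale CARD('n) a t))) / t"

definition profile_exists :: "(real ^ 'n) set \<Rightarrow> bool" where
  "profile_exists F \<longleftrightarrow> (\<forall>a\<in>rates CARD('n). \<exists>L. (log_growth F a \<longlongrightarrow> L) at_top)"

(* Meaningful only when the limit exists. *)
definition profile :: "(real ^ 'n) set \<Rightarrow> (nat \<Rightarrow> real) \<Rightarrow> real" where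
  "profile F a = Lim at_top (log_growth F a)"

definition uniformly_profile_regular :: "(real ^ 'n) set \<Rightarrow> bool" where
  "uniformly_profile_regular F \<longleftrightarrow>
     profile_exists F \<and>
     (\<exists>C\<ge>1. \<exists>t\<^sub>0>0. \<forall>a\<in>normalized_rates CARD('n). \<forall>t\<ge>t\<^sub>0.
        exp (t * profile F a) / C \<le> real (covering_number F (exp_scale CARD('n) a t)) \<and>
        real (covering_number F (exp_scale CARD('n) a t)) \<le> C * exp (t * profile F a))"

end

theory Submission
  imports Defs
begin

text \<open>
  Everything follows from one estimate, uniform in \<open>\<delta>\<close>: up to constant factors, the number of boxes
  with side lengths at most \<open>\<delta>\<^sub>1 \<ge> \<dots> \<ge> \<delta>\<^sub>n\<close> needed to cover \<open>\<Gamma>\<close> is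
  \<open>M(\<delta>) = max\<^sub>i \<delta>\<^sub>i powr (-1/i)\<close> (\<open>nondegenerate_curve_covering_number_bounds\<close>).

  Upper bound. Near a parameter \<open>s\<close> choose an orthonormal frame \<open>e\<^sub>1, \<dots>, e\<^sub>n\<close> with \<open>e\<^sub>i\<close> orthogonal
  to the derivatives of order 1 to \<open>i - 1\<close>. By Taylor's formula a segment of length \<open>h\<close> starting at
  \<open>s\<close> has extent \<open>O(h\<^sup>i)\<close> in direction \<open>e\<^sub>i\<close>, so it fits into one admissible box when \<open>h\<close> is a small
  multiple of \<open>1/M(\<delta>)\<close>. A compact curve is covered by finitely many parametrised arcs, and hence by
  \<open>O(M(\<delta>))\<close> boxes.

  Lower bound. Fix \<open>i\<close>. An admissible box has width at most \<open>n \<delta>\<^sub>i\<close> in every direction orthogonal to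
  its \<open>i - 1\<close> longest edges, and one such unit vector \<open>w\<close> is also orthogonal to the \<open>n - i\<close>
  derivatives of order above \<open>i\<close> at a fixed parameter. Since the derivatives of order 1 to \<open>n\<close> form a
  basis, the coordinate \<open>\<gamma> \<bullet> w\<close> has a derivative of some order \<open>k \<le> i\<close> bounded below on a fixed
  short arc in absolute value. A function with such a \<open>k\<close>-th derivative cannot take values within \<open>O(\<delta>\<^sub>i)\<close>
  of each other at \<open>2\<^sup>k\<close> parameters that are separated by a large multiple of
  \<open>\<delta>\<^sub>i powr (1/i)\<close>. So each box contains a bounded number of the points sampled at this spacing,
  and there are about \<open>\<delta>\<^sub>i powr (-1/i)\<close> of those.

  Along \<open>\<delta> = exp (-t a)\<close> one has \<open>M(\<delta>) = exp (t max\<^sub>i (a\<^sub>i/i))\<close>, which gives the profile and its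
  uniformity. The prints are found by minimising and maximising \<open>M(\<delta>) \<delta>\<^sup>\<alpha>\<close> over the tuples \<open>\<delta>\<close>.
\<close>

section \<open>Prints and profiles from a two-sided bound\<close>

text \<open>The value \<open>M = max\<^sub>i \<delta>\<^sub>i powr (-1/i)\<close> is the reciprocal of the largest \<open>h\<close> with
  \<open>h\<^sup>i \<le> \<delta>\<^sub>i\<close> for all \<open>i\<close>, where \<open>h, h\<^sup>2, \<dots>, h\<^sup>n\<close> is the shape of a curve segment of
  length \<open>h\<close>. So \<open>M\<close> is the expected number of boxes.\<close>

definition scale_count :: "nat \<Rightarrow> (nat \<Rightarrow> real) \<Rightarrow> real" where
  "scale_count n \<delta> = Max ((\<lambda>i. \<delta> i powr (- 1 / real i)) ` {1..n})"

lemma scale_count_ge: "i \<in> {1..n} \<Longrightarrow> \<delta> i powr (- 1 / real i) \<le> scale_count n \<delta>"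
  unfolding scale_count_def by (rule Max_ge) auto

lemma scale_count_attained:
  assumes "1 \<le> n"
  obtains i where "i \<in> {1..n}" "scale_count n \<delta> = \<delta> i powr (- 1 / real i)"
proof -
  have "scale_count n \<delta> \<in> (\<lambda>i. \<delta> i powr (- 1 / real i)) ` {1..n}"
    unfolding scale_count_def using assms by (intro Max_in) auto
  then show ?thesis using that by blast
qed

lemma DeltaD:
  assumes "\<delta> \<in> Delta n" "i \<in> {1..n}"
  shows "0 < \<delta> i" "\<delta> i < 1"
  using assms unfolding Delta_def by (auto simp: PiE_iff)

lemma Delta_antimono:
  assumes "\<delta> \<in> Delta n" "i \<in> {1..n}" "j \<in> {1..n}" "i \<le> j"
  shows "\<delta> j \<le> \<delta> i"
  using assms unfolding Delta_def monotone_on_def by auto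

lemma scale_count_ge_1:
  assumes "1 \<le> n" "\<delta> \<in> Delta n"
  shows "1 \<le> scale_count n \<delta>"
proof -
  have "1 \<le> inverse (\<delta> 1)"
    using DeltaD[OF assms(2), of 1] assms(1) by (simp add: one_le_inverse_iff)
  also have "inverse (\<delta> 1) = \<delta> 1 powr (- 1 / real 1)"
    using DeltaD[OF assms(2), of 1] assms(1) by (simp add: powr_minus)
  also have "\<dots> \<le> scale_count n \<delta>"
    using assms(1) by (intro scale_count_ge) auto
  finally show ?thesis .
qed

lemma eventually_Delta_filter:
  "eventually P (Delta_filter n) \<longleftrightarrow> (\<exists>d>0. \<forall>\<delta>\<in>Delta n. 0 < \<delta> 1 \<longrightarrow> \<delta> 1 < d \<longrightarrow> P \<delta>)"
    (is "?L \<longleftrightarrow> ?R")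
proof
  assume ?L
  then obtain Q where Q: "eventually Q (at_right 0)" "\<And>\<delta>. Q (\<delta> 1) \<Longrightarrow> \<delta> \<in> Delta n \<Longrightarrow> P \<delta>"
    unfolding Delta_filter_def eventually_inf_principal eventually_filtercomap by blast
  then show ?R
    unfolding eventually_at_right_field by (metis)
next
  assume ?R
  then obtain d where d: "d > 0" "\<forall>\<delta>\<in>Delta n. 0 < \<delta> 1 \<longrightarrow> \<delta> 1 < d \<longrightarrow> P \<delta>" by blast
  show ?L
    unfolding Delta_filter_def eventually_inf_principal eventually_filtercomap
    by (rule exI[of _ "\<lambda>x. 0 < x \<and> x < d"])
      (use d in \<open>auto simp: eventually_at_right_field intro: exI[of _ d]\<close>)
qed

lemma Liminf_Delta_filter_pos_iff:
  assumes "1 \<le> n"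
  shows "Liminf (Delta_filter n) (\<lambda>\<delta>. ereal (f \<delta>)) > 0 \<longleftrightarrow>
    (\<exists>c>0. \<exists>d>0. \<forall>\<delta>\<in>Delta n. \<delta> 1 < d \<longrightarrow> c \<le> f \<delta>)" (is "?L \<longleftrightarrow> ?R")
proof
  assume ?L
  then obtain c where c: "0 < ereal c" "ereal c < Liminf (Delta_filter n) (\<lambda>\<delta>. ereal (f \<delta>))"
    using ereal_dense2 by blast
  then have "eventually (\<lambda>\<delta>. ereal c < ereal (f \<delta>)) (Delta_filter n)"
    by (intro less_LiminfD)
  then obtain d where "d > 0" "\<forall>\<delta>\<in>Delta n. 0 < \<delta> 1 \<longrightarrow> \<delta> 1 < d \<longrightarrow> c < f \<delta>"
    by (auto simp: eventually_Delta_filter)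
  then show ?R
    using c(1) DeltaD[of _ n 1] assms
    by (intro exI[of _ c] conjI exI[of _ d]) (auto simp: less_imp_le)
next
  assume ?R
  then obtain c d where c: "c > 0" "d > 0" "\<forall>\<delta>\<in>Delta n. \<delta> 1 < d \<longrightarrow> c \<le> f \<delta>" by blast
  then have "ereal c \<le> Liminf (Delta_filter n) (\<lambda>\<delta>. ereal (f \<delta>))"
    by (intro Liminf_bounded) (auto simp: eventually_Delta_filter)
  then show ?L
    using c(1) by (metis ereal_less(2) less_le_trans)
qed

lemma Limsup_Delta_filter_pos_iff:
  assumes "1 \<le> n"
  shows "Limsup (Delta_filter n) (\<lambda>\<delta>. ereal (f \<delta>)) > 0 \<longleftrightarrow>
    (\<exists>c>0. \<forall>d>0. \<exists>\<delta>\<in>Delta n. \<delta> 1 < d \<and> c \<le> f \<delta>)" (is "?L \<longleftrightarrow> ?R")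
proof
  assume ?L
  then obtain c where c: "0 < ereal c" "ereal c < Limsup (Delta_filter n) (\<lambda>\<delta>. ereal (f \<delta>))"
    using ereal_dense2 by blast
  show ?R
  proof (rule ccontr)
    assume "\<not> ?R"
    then obtain d where "d > 0" "\<forall>\<delta>\<in>Delta n. \<delta> 1 < d \<longrightarrow> f \<delta> < c"
      using c(1) by (metis ereal_less(2) not_le)
    then have "Limsup (Delta_filter n) (\<lambda>\<delta>. ereal (f \<delta>)) \<le> ereal c"
      by (intro Limsup_bounded) (auto simp: eventually_Delta_filter less_imp_le)
    with c(2) show False by simp
  qed
next
  assume ?R
  then obtain c where c: "c > 0" "\<forall>d>0. \<exists>\<delta>\<in>Delta n. \<delta> 1 < d \<and> c \<le> f \<delta>" by blast
  show ?L
  proof (rule ccontr)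
    assume "\<not> ?L"
    then have "Limsup (Delta_filter n) (\<lambda>\<delta>. ereal (f \<delta>)) < ereal c"
      using c(1) by (metis ereal_less(2) le_less_trans not_le)
    from Limsup_lessD[OF this] obtain d where
      "d > 0" "\<forall>\<delta>\<in>Delta n. 0 < \<delta> 1 \<longrightarrow> \<delta> 1 < d \<longrightarrow> f \<delta> < c"
      by (auto simp: eventually_Delta_filter)
    with c(2) DeltaD[of _ n 1] assms show False by fastforce
  qed
qed

lemma small_power_exists:
  fixes e C c d :: real
  assumes "0 < e" "0 < c" "0 < d"
  obtains s where "0 < s" "s < 1" "s < d" "C * s powr e < c"
proof -
  have "((\<lambda>s. C * s powr e) \<longlongrightarrow> C * 0) (at_right 0)"
    using assms(1) by (intro tendsto_intros tendsto_neg_powr tendsto_zero_powrI[of _ _ _ e])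
      (auto simp: eventually_at_right_field intro: exI[of _ 1])
  then have "eventually (\<lambda>s. C * s powr e < c) (at_right 0)"
    using assms(2) by (simp add: order_tendstoD(2))
  then obtain b where b: "b > 0" "\<And>s. 0 < s \<Longrightarrow> s < b \<Longrightarrow> C * s powr e < c"
    unfolding eventually_at_right_field by auto
  define s where "s = min b (min 1 d) / 2"
  have "0 < s" "s < 1" "s < d" "s < b"
    using b(1) assms(3) unfolding s_def by auto
  then show ?thesis using that b(2) by blast
qed

text \<open>With \<open>M\<close> for the scale count, every \<open>\<delta>\<^sub>i\<close> is at least \<open>M powr (-i)\<close>, with equality for
  all \<open>i\<close> at once when \<open>\<delta>\<^sub>i = s\<^sup>i\<close>. This is where the weights \<open>i\<close> of the lower print come from.\<close>

lemma scale_count_powr_le_tuple_powr: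
  assumes n: "1 \<le> n" and \<delta>: "\<delta> \<in> Delta n" and \<alpha>: "\<alpha> \<in> exponents n"
  shows "scale_count n \<delta> powr (- (\<Sum>i=1..n. real i * \<alpha> i)) \<le> tuple_powr n \<delta> \<alpha>"
proof -
  define M where "M = scale_count n \<delta>"
  have M: "1 \<le> M" unfolding M_def by (rule scale_count_ge_1[OF n \<delta>])
  have "M powr (- (\<Sum>i=1..n. real i * \<alpha> i)) = (\<Prod>i\<in>{1..n}. M powr (- (real i * \<alpha> i)))"
    using M by (simp add: powr_sum sum_negf[symmetric])
  also have "\<dots> \<le> tuple_powr n \<delta> \<alpha>"
    unfolding tuple_powr_def
  proof (intro prod_mono conjI)
    fix i assume i: "i \<in> {1..n}"
    have \<alpha>i: "0 \<le> \<alpha> i" using \<alpha> i unfolding exponents_def by (auto simp: PiE_iff)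
    have "M powr (- real i) \<le> (\<delta> i powr (- 1 / real i)) powr (- real i)"
      using scale_count_ge[OF i, of \<delta>] DeltaD[OF \<delta> i] M
      unfolding M_def by (intro powr_mono2') auto
    also have "\<dots> = \<delta> i"
      using i DeltaD[OF \<delta> i] by (simp add: powr_powr)
    finally have "(M powr (- real i)) powr \<alpha> i \<le> \<delta> i powr \<alpha> i"
      using \<alpha>i M by (intro powr_mono2) auto
    then show "M powr (- (real i * \<alpha> i)) \<le> \<delta> i powr \<alpha> i"
      by (simp add: powr_powr)
  qed auto
  finally show ?thesis unfolding M_def .
qed

text \<open>The smallest value of \<open>M \<delta>\<^sup>\<alpha>\<close> for given \<open>M\<close> is \<open>M powr (1 - (\<Sum>i. i \<alpha>\<^sub>i))\<close>, which stays away
  from 0 as \<open>M\<close> tends to infinity exactly when the exponent is nonnegative.\<close>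

lemma lower_print_of_scale_count_bounds:
  fixes F :: "(real ^ 'n) set"
  assumes c: "0 < c" "\<And>\<delta>. \<delta> \<in> Delta CARD('n) \<Longrightarrow>
      c * scale_count CARD('n) \<delta> \<le> real (covering_number F \<delta>)"
    and C: "0 < C" "\<And>\<delta>. \<delta> \<in> Delta CARD('n) \<Longrightarrow>
      real (covering_number F \<delta>) \<le> C * scale_count CARD('n) \<delta>"
  shows "lower_print F = {\<alpha> \<in> exponents CARD('n). (\<Sum>i=1..CARD('n). real i * \<alpha> i) \<le> 1}"
proof -
  define n where "n = CARD('n)"
  have n: "1 \<le> n" unfolding n_def by (simp add: Suc_leI)
  have "(\<exists>b>0. \<exists>d>0. \<forall>\<delta>\<in>Delta n. \<delta> 1 < d \<longrightarrow> b \<le> real (covering_number F \<delta>) * tuple_powr n \<delta> \<alpha>)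
      \<longleftrightarrow> (\<Sum>i=1..n. real i * \<alpha> i) \<le> 1" (is "?L \<longleftrightarrow> ?S \<le> 1")
    if \<alpha>: "\<alpha> \<in> exponents n" for \<alpha>
  proof
    assume S: "?S \<le> 1"
    have "c \<le> real (covering_number F \<delta>) * tuple_powr n \<delta> \<alpha>" if \<delta>: "\<delta> \<in> Delta n" for \<delta>
    proof -
      have M: "1 \<le> scale_count n \<delta>" by (rule scale_count_ge_1[OF n \<delta>])
      have "c \<le> c * scale_count n \<delta> powr (1 - ?S)"
        using S M c(1) by (simp add: ge_one_powr_ge_zero)
      also have "\<dots> = (c * scale_count n \<delta>) * scale_count n \<delta> powr (- ?S)"
        using M by (simp add: powr_diff powr_minus divide_inverse)
      also have "\<dots> \<le> real (covering_number F \<delta>) * tuple_powr n \<delta> \<alpha>"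
        using c(2)[of \<delta>] \<delta> scale_count_powr_le_tuple_powr[OF n \<delta> \<alpha>]
        unfolding n_def by (intro mult_mono) auto
      finally show ?thesis .
    qed
    then show ?L using c(1) zero_less_one by blast
  next
    assume ?L
    then obtain b d where b: "0 < b" "0 < d"
      "\<And>\<delta>. \<delta> \<in> Delta n \<Longrightarrow> \<delta> 1 < d \<Longrightarrow> b \<le> real (covering_number F \<delta>) * tuple_powr n \<delta> \<alpha>"
      by blast
    show "?S \<le> 1"
    proof (rule ccontr)
      assume "\<not> ?S \<le> 1"
      then obtain s where s: "0 < s" "s < 1" "s < d" "C * s powr (?S - 1) < b"
        using small_power_exists[of "?S - 1" b d C] b by auto
      \<comment> \<open>the scales at which all terms of the maximum agree\<close>
      define \<delta> where "\<delta> = (\<lambda>i\<in>{1..n}. s ^ i)"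
      have \<delta>i: "\<delta> i = s powr real i" if "i \<in> {1..n}" for i
        using that s(1) by (simp add: \<delta>_def powr_realpow)
      have \<delta>: "\<delta> \<in> Delta n"
        using s unfolding Delta_def \<delta>_def monotone_on_def
        by (auto simp: power_decreasing power_less_one_iff)
      obtain j where j: "j \<in> {1..n}" "scale_count n \<delta> = \<delta> j powr (- 1 / real j)"
        using scale_count_attained[OF n] by blast
      have M: "scale_count n \<delta> = s powr (-1)"
        unfolding j(2) \<delta>i[OF j(1)] using j(1) by (simp add: powr_powr)
      have "tuple_powr n \<delta> \<alpha> = (\<Prod>i\<in>{1..n}. s powr (real i * \<alpha> i))"
        unfolding tuple_powr_def by (rule prod.cong) (simp_all only: \<delta>i powr_powr)
      then have T: "tuple_powr n \<delta> \<alpha> = s powr ?S"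
        using s(1) by (simp add: powr_sum)
      have "b \<le> real (covering_number F \<delta>) * tuple_powr n \<delta> \<alpha>"
        using b(3)[OF \<delta>] s n by (simp add: \<delta>_def)
      also have "\<dots> \<le> (C * s powr (-1)) * s powr ?S"
        using C(1) C(2)[of \<delta>] \<delta> M T unfolding n_def by (intro mult_mono) auto
      also have "\<dots> = C * s powr (?S - 1)"
        using s(1) by (simp add: powr_diff powr_minus divide_inverse)
      finally show False using s(4) by simp
    qed
  qed
  then show ?thesis
    unfolding lower_print_def n_def[symmetric] Liminf_Delta_filter_pos_iff[OF n] by blast
qed

lemma sum_split_tail:
  assumes "k \<in> {1..n}"
  shows "tail_sum n 1 \<alpha> - tail_sum n k \<alpha> = (\<Sum>i\<in>{1..<k}. \<alpha> i)"
proof -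
  have "{1..n} = {1..<k} \<union> {k..n}" using assms by auto
  then have "tail_sum n 1 \<alpha> = (\<Sum>i\<in>{1..<k}. \<alpha> i) + tail_sum n k \<alpha>"
    unfolding tail_sum_def by (simp add: sum.union_disjoint ivl_disj_int)
  then show ?thesis by simp
qed

lemma prod_split_tail:
  assumes "k \<in> {1..n}"
  shows "tuple_powr n \<delta> \<alpha> = (\<Prod>i\<in>{1..<k}. \<delta> i powr \<alpha> i) * (\<Prod>i\<in>{k..n}. \<delta> i powr \<alpha> i)"
proof -
  have "{1..n} = {1..<k} \<union> {k..n}" using assms by auto
  then show ?thesis
    unfolding tuple_powr_def by (simp add: prod.union_disjoint ivl_disj_int)
qed

lemma tuple_powr_two_scales:
  assumes k: "k \<in> {1..n}" and pos: "0 < s" "0 < r"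
    and \<delta>: "\<And>i. i \<in> {1..n} \<Longrightarrow> \<delta> i = (if i < k then s else r)"
  shows "tuple_powr n \<delta> \<alpha> = s powr (tail_sum n 1 \<alpha> - tail_sum n k \<alpha>) * r powr tail_sum n k \<alpha>"
proof -
  have "(\<Prod>i\<in>{1..<k}. \<delta> i powr \<alpha> i) = s powr (\<Sum>i\<in>{1..<k}. \<alpha> i)"
    using k pos \<delta> by (simp add: powr_sum)
  moreover have "(\<Prod>i\<in>{k..n}. \<delta> i powr \<alpha> i) = r powr tail_sum n k \<alpha>"
    unfolding tail_sum_def using k pos \<delta> by (simp add: powr_sum)
  ultimately show ?thesis
    unfolding prod_split_tail[OF k] sum_split_tail[OF k] by simp
qed

lemma tuple_powr_le_two_scales:
  assumes k: "k \<in> {1..n}" and \<delta>: "\<delta> \<in> Delta n" and \<alpha>: "\<alpha> \<in> exponents n"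
  shows "tuple_powr n \<delta> \<alpha> \<le> \<delta> 1 powr (tail_sum n 1 \<alpha> - tail_sum n k \<alpha>) * \<delta> k powr tail_sum n k \<alpha>"
proof -
  define \<delta>' where "\<delta>' i = (if i < k then \<delta> 1 else \<delta> k)" for i
  have "tuple_powr n \<delta> \<alpha> \<le> tuple_powr n \<delta>' \<alpha>"
    unfolding tuple_powr_def
  proof (intro prod_mono conjI)
    fix i assume i: "i \<in> {1..n}"
    show "\<delta> i powr \<alpha> i \<le> \<delta>' i powr \<alpha> i"
      using Delta_antimono[OF \<delta>, of 1 i] Delta_antimono[OF \<delta> k i] i DeltaD[OF \<delta> i] \<alpha>
      by (intro powr_mono2) (auto simp: \<delta>'_def exponents_def PiE_iff)
  qed auto
  also have "\<dots> = \<delta> 1 powr (tail_sum n 1 \<alpha> - tail_sum n k \<alpha>) * \<delta> k powr tail_sum n k \<alpha>"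
    using k DeltaD[OF \<delta>, of 1] DeltaD[OF \<delta> k]
    by (intro tuple_powr_two_scales) (auto simp: \<delta>'_def)
  finally show ?thesis .
qed

lemma two_scale_tuple_in_Delta:
  assumes "0 < r" "r \<le> s" "s < 1"
  shows "(\<lambda>i\<in>{1..n}. if i < k then s else r) \<in> Delta n"
  using assms unfolding Delta_def monotone_on_def by auto

text \<open>The limsup of a finite maximum is the maximum of the limsups, so each term
  \<open>\<delta>\<^sub>k powr (-1/k) * \<delta>\<^sup>\<alpha>\<close> is maximised on its own, and the extremal tuples take only two values,
  \<open>s\<close> before position \<open>k\<close> and \<open>r \<le> s\<close> from there on. The term is then
  \<open>s powr (S\<^sub>1 - S\<^sub>k) * r powr (S\<^sub>k - 1/k)\<close>. For \<open>k \<ge> 2\<close> and \<open>S\<^sub>k < 1/k\<close> it is unbounded as \<open>r\<close>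
  decreases with \<open>s\<close> fixed; for \<open>S\<^sub>k \<ge> 1/k\<close> it is largest at \<open>r = s\<close>, with value
  \<open>s powr (S\<^sub>1 - 1/k)\<close>, and tends to 0 with \<open>s\<close> as soon as \<open>S\<^sub>1 > 1\<close>. For \<open>S\<^sub>1 \<le> 1\<close> constant tuples keep
  the term \<open>k = 1\<close> above 1.\<close>

lemma upper_print_of_scale_count_bounds:
  fixes F :: "(real ^ 'n) set"
  assumes c: "0 < c" "\<And>\<delta>. \<delta> \<in> Delta CARD('n) \<Longrightarrow>
      c * scale_count CARD('n) \<delta> \<le> real (covering_number F \<delta>)"
    and C: "0 < C" "\<And>\<delta>. \<delta> \<in> Delta CARD('n) \<Longrightarrow>
      real (covering_number F \<delta>) \<le> C * scale_count CARD('n) \<delta>"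
  shows "upper_print F = {\<alpha> \<in> exponents CARD('n). tail_sum CARD('n) 1 \<alpha> \<le> 1} \<union>
      (\<Union>k\<in>{2..CARD('n)}. {\<alpha> \<in> exponents CARD('n). tail_sum CARD('n) k \<alpha> < 1 / real k})"
proof -
  define n where "n = CARD('n)"
  have n: "1 \<le> n" unfolding n_def by (simp add: Suc_leI)
  have "(\<exists>b>0. \<forall>d>0. \<exists>\<delta>\<in>Delta n. \<delta> 1 < d \<and> b \<le> real (covering_number F \<delta>) * tuple_powr n \<delta> \<alpha>)
      \<longleftrightarrow> tail_sum n 1 \<alpha> \<le> 1 \<or> (\<exists>k\<in>{2..n}. tail_sum n k \<alpha> < 1 / real k)" (is "?L \<longleftrightarrow> ?R")
    if \<alpha>: "\<alpha> \<in> exponents n" for \<alpha>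
  proof
    assume R: ?R
    have "\<exists>\<delta>\<in>Delta n. \<delta> 1 < d \<and> c \<le> real (covering_number F \<delta>) * tuple_powr n \<delta> \<alpha>"
      if d: "d > 0" for d
    proof -
      define s where "s = min d 1 / 2"
      have s: "0 < s" "s < 1" "s < d" using d by (auto simp: s_def)
      have "\<exists>k\<in>{1..n}. \<exists>r. 0 < r \<and> r \<le> s \<and>
          1 \<le> s powr (tail_sum n 1 \<alpha> - tail_sum n k \<alpha>) * r powr (tail_sum n k \<alpha> - 1 / real k)"
      proof (cases "tail_sum n 1 \<alpha> \<le> 1")
        case True
        have "1 \<le> s powr (tail_sum n 1 \<alpha> - 1)"
          using s True powr_mono'[of "tail_sum n 1 \<alpha> - 1" 0 s] by simp
        then show ?thesis
          using n s by (intro bexI[of _ 1] exI[of _ s]) auto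
      next
        case False
        then obtain k where k: "k \<in> {2..n}" "tail_sum n k \<alpha> < 1 / real k" using R by blast
        define e where "e = 1 / real k - tail_sum n k \<alpha>"
        have e: "e > 0" using k by (simp add: e_def)
        define A where "A = s powr (tail_sum n 1 \<alpha> - tail_sum n k \<alpha>)"
        have A: "A > 0" using s by (simp add: A_def)
        \<comment> \<open>with \<open>s\<close> fixed the product tends to infinity as \<open>r\<close> tends to 0\<close>
        define r where "r = min s (A powr (1 / e))"
        have r: "0 < r" "r \<le> s" using s A by (auto simp: r_def)
        have "inverse A = (A powr (1 / e)) powr (- e)"
          using A e by (simp add: powr_powr powr_minus)
        also have "\<dots> \<le> r powr (- e)"
          using r e by (intro powr_mono2') (auto simp: r_def)
        finally have "1 \<le> A * r powr (- e)"
          using A by (simp add: field_simps)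
        then show ?thesis
          using k r by (intro bexI[of _ k] exI[of _ r]) (auto simp: A_def e_def)
      qed
      then obtain k r where kr: "k \<in> {1..n}" "0 < r" "r \<le> s"
        "1 \<le> s powr (tail_sum n 1 \<alpha> - tail_sum n k \<alpha>) * r powr (tail_sum n k \<alpha> - 1 / real k)"
        by blast
      define \<delta> where "\<delta> = (\<lambda>i\<in>{1..n}. if i < k then s else r)"
      have \<delta>: "\<delta> \<in> Delta n"
        unfolding \<delta>_def using kr s by (intro two_scale_tuple_in_Delta) auto
      have T: "tuple_powr n \<delta> \<alpha> = s powr (tail_sum n 1 \<alpha> - tail_sum n k \<alpha>) * r powr tail_sum n k \<alpha>"
        using kr s by (intro tuple_powr_two_scales) (auto simp: \<delta>_def)
      have "c \<le> c * (s powr (tail_sum n 1 \<alpha> - tail_sum n k \<alpha>) * r powr (tail_sum n k \<alpha> - 1 / real k))"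
        using kr(4) c(1) by simp
      also have "\<dots> = (c * \<delta> k powr (- 1 / real k)) * tuple_powr n \<delta> \<alpha>"
        unfolding T using kr by (simp add: \<delta>_def powr_diff powr_minus_divide)
      also have "\<dots> \<le> (c * scale_count n \<delta>) * tuple_powr n \<delta> \<alpha>"
        using c(1) scale_count_ge[OF kr(1), of \<delta>] s kr unfolding T
        by (intro mult_right_mono mult_left_mono) auto
      also have "\<dots> \<le> real (covering_number F \<delta>) * tuple_powr n \<delta> \<alpha>"
        using c(2)[of \<delta>] \<delta> unfolding n_def T[unfolded n_def] by (intro mult_right_mono) auto
      finally have "c \<le> real (covering_number F \<delta>) * tuple_powr n \<delta> \<alpha>" .
      moreover have "\<delta> 1 < d" using n kr s by (auto simp: \<delta>_def)
      ultimately show ?thesis using \<delta> by blast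
    qed
    then show ?L using c(1) by blast
  next
    assume ?L
    then obtain b where b: "0 < b"
      "\<And>d. d > 0 \<Longrightarrow> \<exists>\<delta>\<in>Delta n. \<delta> 1 < d \<and> b \<le> real (covering_number F \<delta>) * tuple_powr n \<delta> \<alpha>"
      by blast
    show ?R
    proof (rule ccontr)
      assume R: "\<not> ?R"
      then have S1: "1 < tail_sum n 1 \<alpha>" by auto
      have Sk: "1 / real k \<le> tail_sum n k \<alpha>" if "k \<in> {1..n}" for k
      proof (cases "k = 1")
        case False
        then have "k \<in> {2..n}" using that by auto
        then show ?thesis using R by force
      qed (use S1 in simp)
      \<comment> \<open>the value of \<open>\<delta> 1\<close> at which the bound \<open>C * \<delta> 1 powr (S\<^sub>1 - 1)\<close> drops to \<open>b\<close>\<close>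
      define d where "d = (b / C) powr (1 / (tail_sum n 1 \<alpha> - 1))"
      have "d > 0" using b(1) C(1) by (simp add: d_def)
      then obtain \<delta> where \<delta>: "\<delta> \<in> Delta n" "\<delta> 1 < d"
        "b \<le> real (covering_number F \<delta>) * tuple_powr n \<delta> \<alpha>"
        using b(2) by blast
      have \<delta>1: "0 < \<delta> 1" "\<delta> 1 < 1" using DeltaD[OF \<delta>(1), of 1] n by auto
      obtain k where k: "k \<in> {1..n}" "scale_count n \<delta> = \<delta> k powr (- 1 / real k)"
        using scale_count_attained[OF n] by blast
      have \<delta>k: "0 < \<delta> k" "\<delta> k \<le> \<delta> 1"
        using DeltaD[OF \<delta>(1) k(1)] Delta_antimono[OF \<delta>(1), of 1 k] k(1) by auto
      have "b \<le> (C * \<delta> k powr (- 1 / real k)) *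
          (\<delta> 1 powr (tail_sum n 1 \<alpha> - tail_sum n k \<alpha>) * \<delta> k powr tail_sum n k \<alpha>)"
        using \<delta>(3) C(2)[of \<delta>] \<delta>(1) k(2) tuple_powr_le_two_scales[OF k(1) \<delta>(1) \<alpha>]
        unfolding n_def
        by (elim order_trans, intro mult_mono) (auto simp: tuple_powr_def intro: prod_nonneg less_imp_le[OF C(1)])
      also have "\<dots> = C * (\<delta> 1 powr (tail_sum n 1 \<alpha> - tail_sum n k \<alpha>) * \<delta> k powr (tail_sum n k \<alpha> - 1 / real k))"
        using \<delta>k by (simp add: powr_diff powr_minus_divide)
      also have "\<dots> \<le> C * (\<delta> 1 powr (tail_sum n 1 \<alpha> - tail_sum n k \<alpha>) * \<delta> 1 powr (tail_sum n k \<alpha> - 1 / real k))"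
        using C(1) \<delta>k Sk[OF k(1)] by (intro mult_left_mono powr_mono2) auto
      also have "\<dots> = C * \<delta> 1 powr (tail_sum n 1 \<alpha> - 1 / real k)"
        by (simp add: powr_add[symmetric])
      also have "\<dots> \<le> C * \<delta> 1 powr (tail_sum n 1 \<alpha> - 1)"
        using C(1) \<delta>1 k(1) by (intro mult_left_mono powr_mono') (auto simp: field_simps)
      also have "\<dots> < C * d powr (tail_sum n 1 \<alpha> - 1)"
        using C(1) \<delta>1 \<delta>(2) S1 by (intro mult_strict_left_mono powr_less_mono2) auto
      also have "\<dots> = b"
        using S1 b(1) C(1) by (simp add: d_def powr_powr)
      finally show False by simp
    qed
  qed
  then show ?thesis
    unfolding upper_print_def n_def[symmetric] Limsup_Delta_filter_pos_iff[OF n] by blast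
qed

lemma exp_scale_in_Delta:
  assumes "a \<in> rates n" "0 < t"
  shows "exp_scale n a t \<in> Delta n"
  using assms unfolding exp_scale_def rates_def Delta_def monotone_on_def by (auto simp: PiE_iff)

lemma scale_count_exp_scale:
  assumes n: "1 \<le> n" and t: "0 < t"
  shows "scale_count n (exp_scale n a t) = exp (t * Max ((\<lambda>i. a i / real i) ` {1..n}))"
proof -
  have "mono (\<lambda>x::real. exp (t * x))"
    using t by (intro monoI) simp
  then have "exp (t * Max ((\<lambda>i. a i / real i) ` {1..n})) =
      Max ((\<lambda>x. exp (t * x)) ` (\<lambda>i. a i / real i) ` {1..n})"
    using n by (intro mono_Max_commute) auto
  also have "\<dots> = scale_count n (exp_scale n a t)"
    unfolding scale_count_def image_image
    by (intro arg_cong[where f = Max] image_cong) (auto simp: exp_scale_def powr_def)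
  finally show ?thesis ..
qed

lemma log_growth_tendsto_of_scale_count_bounds:
  fixes F :: "(real ^ 'n) set"
  assumes c: "0 < c" "\<And>\<delta>. \<delta> \<in> Delta CARD('n) \<Longrightarrow>
      c * scale_count CARD('n) \<delta> \<le> real (covering_number F \<delta>)"
    and C: "0 < C" "\<And>\<delta>. \<delta> \<in> Delta CARD('n) \<Longrightarrow>
      real (covering_number F \<delta>) \<le> C * scale_count CARD('n) \<delta>"
    and a: "a \<in> rates CARD('n)"
  shows "(log_growth F a \<longlongrightarrow> Max ((\<lambda>i. a i / real i) ` {1..CARD('n)})) at_top"
proof -
  define \<rho> where "\<rho> = Max ((\<lambda>i. a i / real i) ` {1..CARD('n)})"
  have n: "1 \<le> CARD('n)" by (simp add: Suc_leI)
  have bounds: "ln c / t + \<rho> \<le> log_growth F a t \<and> log_growth F a t \<le> ln C / t + \<rho>" if t: "0 < t" for t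
  proof -
    let ?N = "real (covering_number F (exp_scale CARD('n) a t))"
    have N: "c * exp (t * \<rho>) \<le> ?N" "?N \<le> C * exp (t * \<rho>)"
      using c(2)[OF exp_scale_in_Delta[OF a t]] C(2)[OF exp_scale_in_Delta[OF a t]]
      unfolding scale_count_exp_scale[OF n t] \<rho>_def by auto
    have "0 < c * exp (t * \<rho>)" using c(1) by simp
    then have "ln (c * exp (t * \<rho>)) \<le> ln ?N" "ln ?N \<le> ln (C * exp (t * \<rho>))"
      using N by (auto simp del: ln_mult intro!: ln_mono)
    then have "ln c + t * \<rho> \<le> ln ?N" "ln ?N \<le> ln C + t * \<rho>"
      using c(1) C(1) by (auto simp: ln_mult)
    then have "(ln c + t * \<rho>) / t \<le> ln ?N / t" "ln ?N / t \<le> (ln C + t * \<rho>) / t"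
      using t by (auto intro: divide_right_mono)
    then show ?thesis
      unfolding log_growth_def using t by (simp add: add_divide_distrib)
  qed
  have lim: "((\<lambda>t. b / t + \<rho>) \<longlongrightarrow> \<rho>) at_top" for b :: real
  proof -
    have "((\<lambda>t. b / t) \<longlongrightarrow> 0) at_top"
      by (rule tendsto_divide_0[OF tendsto_const]) (simp add: filterlim_at_top_imp_at_infinity filterlim_ident)
    from tendsto_add[OF this tendsto_const[of \<rho>]] show ?thesis by simp
  qed
  show ?thesis
    unfolding \<rho>_def[symmetric]
    by (rule tendsto_sandwich[OF _ _ lim[of "ln c"] lim[of "ln C"]])
      (use bounds in \<open>auto intro: eventually_mono[OF eventually_gt_at_top[of 0]]\<close>)
qed

lemma uniformly_profile_regular_of_scale_count_bounds:
  fixes F :: "(real ^ 'n) set"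
  assumes c: "0 < c" "\<And>\<delta>. \<delta> \<in> Delta CARD('n) \<Longrightarrow>
      c * scale_count CARD('n) \<delta> \<le> real (covering_number F \<delta>)"
    and C: "0 < C" "\<And>\<delta>. \<delta> \<in> Delta CARD('n) \<Longrightarrow>
      real (covering_number F \<delta>) \<le> C * scale_count CARD('n) \<delta>"
  shows "uniformly_profile_regular F"
    and "\<And>a. a \<in> rates CARD('n) \<Longrightarrow> profile F a = Max ((\<lambda>i. a i / real i) ` {1..CARD('n)})"
proof -
  have lim: "(log_growth F a \<longlongrightarrow> Max ((\<lambda>i. a i / real i) ` {1..CARD('n)})) at_top"
    if "a \<in> rates CARD('n)" for a
    by (rule log_growth_tendsto_of_scale_count_bounds[where c = c and C = C]) (use c C that in auto)
  show \<rho>: "profile F a = Max ((\<lambda>i. a i / real i) ` {1..CARD('n)})" if "a \<in> rates CARD('n)" for a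
    unfolding profile_def by (rule tendsto_Lim[OF _ lim[OF that]]) auto
  have n: "1 \<le> CARD('n)" by (simp add: Suc_leI)
  define K where "K = max 1 (max C (1 / c))"
  have K: "1 \<le> K" "C \<le> K" "1 / K \<le> c"
  proof -
    show "1 \<le> K" "C \<le> K" unfolding K_def by auto
    have "1 / c \<le> K" unfolding K_def by auto
    then show "1 / K \<le> c" using c(1) \<open>1 \<le> K\<close> by (simp add: field_simps)
  qed
  have "exp (t * profile F a) / K \<le> real (covering_number F (exp_scale CARD('n) a t)) \<and>
        real (covering_number F (exp_scale CARD('n) a t)) \<le> K * exp (t * profile F a)"
    if a: "a \<in> normalized_rates CARD('n)" and t: "1 \<le> t" for a t
  proof -
    have a': "a \<in> rates CARD('n)" using a unfolding normalized_rates_def by simp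
    have t': "0 < t" using t by simp
    let ?E = "exp (t * profile F a)"
    have E: "scale_count CARD('n) (exp_scale CARD('n) a t) = ?E"
      unfolding \<rho>[OF a'] by (rule scale_count_exp_scale[OF n t'])
    have "?E / K \<le> c * ?E" "C * ?E \<le> K * ?E"
      using mult_right_mono[OF K(3), of ?E] K(2) by auto
    then show ?thesis
      using c(2)[OF exp_scale_in_Delta[OF a' t']] C(2)[OF exp_scale_in_Delta[OF a' t']]
      unfolding E by linarith
  qed
  then show "uniformly_profile_regular F"
    unfolding uniformly_profile_regular_def profile_exists_def
    using lim K(1) zero_less_one by blast
qed

section \<open>Functions of class \<open>C\<^sup>k\<close>\<close>

lemma iter_vderiv_0 [simp]: "iter_vderiv 0 f = f"
  by (simp add: iter_vderiv_def)

lemma iter_vderiv_Suc: "iter_vderiv (Suc k) f s = vector_derivative (iter_vderiv k f) (at s)"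
  by (simp add: iter_vderiv_def)

lemma iter_vderiv_Suc2: "iter_vderiv (Suc k) f = iter_vderiv k (\<lambda>s. vector_derivative f (at s))"
  unfolding iter_vderiv_def by (simp only: funpow_Suc_right o_apply)

lemma iter_vderiv_cong:
  assumes "open J" "\<And>s. s \<in> J \<Longrightarrow> f s = g s" "s \<in> J"
  shows "iter_vderiv k f s = iter_vderiv k g s"
  using assms(3)
proof (induction k arbitrary: s)
  case (Suc k)
  have "(iter_vderiv k f has_vector_derivative D) (at s) \<longleftrightarrow>
        (iter_vderiv k g has_vector_derivative D) (at s)" for D
    using has_vector_derivative_transform_within_open[OF _ assms(1) Suc.prems] Suc.IH by metis
  then show ?case
    by (simp add: iter_vderiv_Suc vector_derivative_def)
qed (simp add: assms(2))

lemma Ck_on_0: "Ck_on 0 f J \<longleftrightarrow> continuous_on J f"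
  by (simp add: Ck_on_def)

lemma Ck_on_Suc:
  assumes "open J"
  shows "Ck_on (Suc k) f J \<longleftrightarrow>
    (\<forall>s\<in>J. f differentiable (at s)) \<and> Ck_on k (\<lambda>s. vector_derivative f (at s)) J"
  unfolding Ck_on_def All_less_Suc2 by (auto simp: iter_vderiv_Suc2)

lemma Ck_on_cong:
  assumes "open J" "\<And>s. s \<in> J \<Longrightarrow> f s = g s" "Ck_on k f J"
  shows "Ck_on k g J"
proof -
  have eq: "iter_vderiv j g s = iter_vderiv j f s" if "s \<in> J" for j s
    using iter_vderiv_cong[OF assms(1,2) that] by simp
  have "iter_vderiv j g differentiable (at s)" if "j < k" "s \<in> J" for j s
  proof -
    have "iter_vderiv j f differentiable (at s)"
      using assms(3) that unfolding Ck_on_def by blast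
    then show ?thesis
      unfolding differentiable_def
      using has_derivative_transform_within_open[OF _ assms(1) that(2)] eq by metis
  qed
  moreover have "continuous_on J (iter_vderiv k g)"
    using assms(3) eq unfolding Ck_on_def by (simp cong: continuous_on_cong)
  ultimately show ?thesis unfolding Ck_on_def by blast
qed

text \<open>Together with the next lemma this turns \<open>C\<^sup>k\<close> into a recursive notion, so that closure
  properties are proved by induction on \<open>k\<close> without formulas for higher derivatives.\<close>

lemma Ck_on_SucI:
  assumes "open J" "\<And>s. s \<in> J \<Longrightarrow> (f has_vector_derivative f' s) (at s)" "Ck_on k f' J"
  shows "Ck_on (Suc k) f J"
  unfolding Ck_on_Suc[OF assms(1)]
proof (intro conjI ballI)
  show "f differentiable at s" if "s \<in> J" for s
    using assms(2)[OF that] by (rule differentiableI_vector)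
  show "Ck_on k (\<lambda>s. vector_derivative f (at s)) J"
    using assms(3) by (rule Ck_on_cong[OF assms(1), rotated]) (simp add: vector_derivative_at[OF assms(2)])
qed

lemma Ck_on_SucD:
  assumes "open J" "Ck_on (Suc k) f J"
  shows "s \<in> J \<Longrightarrow> (f has_vector_derivative vector_derivative f (at s)) (at s)"
    and "Ck_on k (\<lambda>s. vector_derivative f (at s)) J"
  using assms(2) unfolding Ck_on_Suc[OF assms(1)] by (auto simp: vector_derivative_works[symmetric])

lemma Ck_on_iter_has_vector_derivative:
  assumes "Ck_on k f J" "j < k" "s \<in> J"
  shows "(iter_vderiv j f has_vector_derivative iter_vderiv (Suc j) f s) (at s)"
  using assms unfolding Ck_on_def by (simp add: iter_vderiv_Suc vector_derivative_works[symmetric])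

lemma Ck_on_iter_continuous:
  assumes "Ck_on k f J" "j \<le> k"
  shows "continuous_on J (iter_vderiv j f)"
proof (cases "j = k")
  case False
  then have "j < k" using assms(2) by simp
  then have "\<forall>s\<in>J. iter_vderiv j f differentiable (at s)"
    using assms(1) unfolding Ck_on_def by blast
  then show ?thesis
    by (intro continuous_at_imp_continuous_on ballI differentiable_imp_continuous_within) blast
qed (use assms in \<open>simp add: Ck_on_def\<close>)

lemma Ck_on_mono:
  assumes "Ck_on k f J" "j \<le> k"
  shows "Ck_on j f J"
  using assms Ck_on_iter_continuous[OF assms] unfolding Ck_on_def by auto

lemma Ck_on_subset:
  assumes "Ck_on k f J" "I \<subseteq> J"
  shows "Ck_on k f I"
  using assms continuous_on_subset unfolding Ck_on_def by blast

lemma Ck_on_add: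
  assumes "open J" "Ck_on k f J" "Ck_on k g J"
  shows "Ck_on k (\<lambda>s. f s + g s) J"
  using assms(2,3)
proof (induction k arbitrary: f g)
  case 0
  then show ?case by (simp add: Ck_on_0 continuous_on_add)
next
  case (Suc k)
  show ?case
    by (rule Ck_on_SucI[OF assms(1) has_vector_derivative_add[OF
          Ck_on_SucD(1)[OF assms(1) Suc.prems(1)] Ck_on_SucD(1)[OF assms(1) Suc.prems(2)]]])
      (use Suc.IH Ck_on_SucD(2)[OF assms(1) Suc.prems(1)] Ck_on_SucD(2)[OF assms(1) Suc.prems(2)]
        in auto)
qed

lemma Ck_on_minus:
  assumes "open J" "Ck_on k f J"
  shows "Ck_on k (\<lambda>s. - f s) J"
  using assms(2)
proof (induction k arbitrary: f)
  case 0
  then show ?case by (simp add: Ck_on_0 continuous_on_minus)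
next
  case (Suc k)
  show ?case
    by (rule Ck_on_SucI[OF assms(1) has_vector_derivative_minus[OF
          Ck_on_SucD(1)[OF assms(1) Suc.prems]]])
      (use Suc.IH Ck_on_SucD(2)[OF assms(1) Suc.prems] in auto)
qed

lemma Ck_on_bilinear:
  assumes "bounded_bilinear h" "open J" "Ck_on k f J" "Ck_on k g J"
  shows "Ck_on k (\<lambda>s. h (f s) (g s)) J"
  using assms(3,4)
proof (induction k arbitrary: f g)
  case 0
  then show ?case by (simp add: Ck_on_0 bounded_bilinear.continuous_on[OF assms(1)])
next
  case (Suc k)
  note f = Ck_on_SucD[OF assms(2) Suc.prems(1)] and g = Ck_on_SucD[OF assms(2) Suc.prems(2)]
  show ?case
    by (rule Ck_on_SucI[OF assms(2) bounded_bilinear.has_vector_derivative[OF assms(1) f(1) g(1)]])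
      (auto intro!: Ck_on_add[OF assms(2)] Suc.IH f(2) g(2) Ck_on_mono[OF Suc.prems(1)]
        Ck_on_mono[OF Suc.prems(2)])
qed

lemma has_vector_derivative_inverse_norm:
  fixes v :: "real \<Rightarrow> 'a::real_inner"
  assumes v: "(v has_vector_derivative v') (at s)" and nz: "v s \<noteq> 0"
  shows "((\<lambda>s. inverse (norm (v s))) has_vector_derivative
    - ((v s \<bullet> v') * (inverse (norm (v s)) * (inverse (norm (v s)) * inverse (norm (v s)))))) (at s)"
proof -
  have "((\<lambda>s. v s \<bullet> v s) has_vector_derivative v s \<bullet> v' + v' \<bullet> v s) (at s)"
    by (rule bounded_bilinear.has_vector_derivative[OF bounded_bilinear_inner v v])
  then have "((\<lambda>s. v s \<bullet> v s) has_real_derivative 2 * (v s \<bullet> v')) (at s)"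
    by (simp add: has_real_derivative_iff_has_vector_derivative inner_commute)
  moreover define q where "q = (\<lambda>s. v s \<bullet> v s)"
  ultimately have dq: "(q has_real_derivative 2 * (v s \<bullet> v')) (at s)" by simp
  have "q s > 0" using nz by (simp add: q_def)
  then have "((\<lambda>s. inverse (sqrt (q s))) has_real_derivative
     - (inverse (sqrt (q s)) * (inverse (sqrt (q s)) / 2 * (2 * (v s \<bullet> v'))) * inverse (sqrt (q s)))) (at s)"
    by (auto intro!: derivative_eq_intros dq)
  then show ?thesis
    unfolding norm_eq_sqrt_inner has_real_derivative_iff_has_vector_derivative q_def
    by (simp add: algebra_simps)
qed

text \<open>The derivative of \<open>u = 1/|v|\<close> is \<open>- (v \<bullet> v') u\<^sup>3\<close>, so \<open>u\<close> is of class \<open>C\<^sup>k\<^sup>+\<^sup>1\<close> once it is of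
  class \<open>C\<^sup>k\<close>.\<close>

lemma Ck_on_inverse_norm:
  fixes v :: "real \<Rightarrow> 'a::real_inner"
  assumes "open J" "Ck_on k v J" "\<And>s. s \<in> J \<Longrightarrow> v s \<noteq> 0"
  shows "Ck_on k (\<lambda>s. inverse (norm (v s))) J"
  using assms(2)
proof (induction k)
  case 0
  then show ?case using assms(3) by (auto simp: Ck_on_0 intro!: continuous_intros)
next
  case (Suc k)
  have v: "Ck_on k v J" using Suc.prems by (rule Ck_on_mono) simp
  note u = Suc.IH[OF v]
  show ?case
    by (rule Ck_on_SucI[OF assms(1) has_vector_derivative_inverse_norm[OF
          Ck_on_SucD(1)[OF assms(1) Suc.prems]]])
      (auto intro!: Ck_on_minus[OF assms(1)] Ck_on_bilinear[OF bounded_bilinear_mult assms(1)]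
        Ck_on_bilinear[OF bounded_bilinear_inner assms(1)] u v
        Ck_on_SucD(2)[OF assms(1) Suc.prems] assms(3))
qed

text \<open>A solution \<open>\<tau>\<close> of the autonomous equation \<open>\<tau>' = u \<circ> \<tau>\<close> keeps the class of \<open>f\<close> under
  composition, since \<open>(f \<circ> \<tau>)' = (u f') \<circ> \<tau>\<close> has the same shape.\<close>

lemma Ck_on_compose_flow:
  assumes "open J" "open I" "\<tau> ` I \<subseteq> J" "Ck_on (k - 1) u J" "Ck_on k f J"
    and \<tau>: "\<And>s. s \<in> I \<Longrightarrow> (\<tau> has_vector_derivative u (\<tau> s)) (at s)"
  shows "Ck_on k (f \<circ> \<tau>) I"
  using assms(4,5)
proof (induction k arbitrary: f)
  case 0
  have "continuous_on I \<tau>"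
    using \<tau> by (meson continuous_at_imp_continuous_on has_vector_derivative_continuous)
  then show ?case
    using 0 assms(3) unfolding Ck_on_0 by (intro continuous_on_compose) (auto intro: continuous_on_subset)
next
  case (Suc k)
  note f = Ck_on_SucD[OF assms(1) Suc.prems(2)]
  have u: "Ck_on k u J" using Suc.prems(1) by simp
  have "Ck_on k ((\<lambda>x. u x *\<^sub>R vector_derivative f (at x)) \<circ> \<tau>) I"
    using u f(2) by (intro Suc.IH Ck_on_bilinear[OF bounded_bilinear_scaleR assms(1)] Ck_on_mono[OF u]) auto
  moreover have "(f \<circ> \<tau> has_vector_derivative ((\<lambda>x. u x *\<^sub>R vector_derivative f (at x)) \<circ> \<tau>) s) (at s)"
    if "s \<in> I" for s
    using vector_diff_chain_at[OF \<tau>[OF that] f(1)] assms(3) that by auto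
  ultimately show ?case by (rule Ck_on_SucI[OF assms(2), rotated])
qed

section \<open>Parametrisation by arc length\<close>

text \<open>With \<open>w\<close> the speed of a curve, \<open>\<sigma>\<close> is arc length and \<open>\<tau>\<close> the parameter as a function of arc
  length.\<close>

lemma inverse_primitive_exists:
  fixes w :: "real \<Rightarrow> real"
  assumes ab: "a < b" and cont: "continuous_on {a..b} w" and pos: "\<And>t. t \<in> {a..b} \<Longrightarrow> 0 < w t"
  obtains L \<tau> \<sigma> where "0 < L" "homeomorphism {0<..<L} {a<..<b} \<tau> \<sigma>"
    "\<And>s. s \<in> {0<..<L} \<Longrightarrow> (\<tau> has_vector_derivative inverse (w (\<tau> s))) (at s)"
proof -
  define \<sigma> where "\<sigma> t = integral {a..t} w" for t
  have d\<sigma>: "(\<sigma> has_real_derivative w t) (at t within {a..b})" if "t \<in> {a..b}" for t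
    unfolding \<sigma>_def by (rule integral_has_real_derivative[OF cont that])
  have d\<sigma>': "(\<sigma> has_real_derivative w t) (at t)" if "t \<in> {a<..<b}" for t
    using d\<sigma>[of t] that by (simp add: at_within_Icc_at)
  have c\<sigma>: "continuous_on {a..b} \<sigma>"
    using d\<sigma> by (meson DERIV_continuous continuous_on_eq_continuous_within)
  have mono: "\<sigma> x < \<sigma> y" if "a \<le> x" "x < y" "y \<le> b" for x y
  proof (rule DERIV_pos_imp_increasing_open[OF that(2)])
    show "\<exists>D. DERIV \<sigma> t :> D \<and> 0 < D" if "x < t" "t < y" for t
      using d\<sigma>'[of t] pos[of t] that \<open>a \<le> x\<close> \<open>y \<le> b\<close> by auto
    show "continuous_on {x..y} \<sigma>"
      by (rule continuous_on_subset[OF c\<sigma>]) (use that in auto)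
  qed
  have \<sigma>a: "\<sigma> a = 0" by (simp add: \<sigma>_def)
  define L where "L = \<sigma> b"
  have L: "0 < L" using mono[of a b] ab \<sigma>a by (simp add: L_def)
  have inj: "inj_on \<sigma> {a..b}"
    by (rule linorder_inj_onI) (use mono in \<open>force+\<close>)
  have img: "\<sigma> ` {a<..<b} = {0<..<L}"
  proof (intro equalityI subsetI)
    fix y assume "y \<in> \<sigma> ` {a<..<b}"
    then show "y \<in> {0<..<L}" using mono[of a] mono[of _ b] \<sigma>a by (auto simp: L_def)
  next
    fix y assume y: "y \<in> {0<..<L}"
    then obtain x where x: "a \<le> x" "x \<le> b" "\<sigma> x = y"
      using IVT'[of \<sigma> a y b] c\<sigma> ab \<sigma>a by (auto simp: L_def)
    then have "x \<noteq> a" "x \<noteq> b" using y \<sigma>a by (auto simp: L_def)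
    then show "y \<in> \<sigma> ` {a<..<b}" using x by auto
  qed
  obtain \<tau> where "homeomorphism {a..b} (\<sigma> ` {a..b}) \<sigma> \<tau>"
    using homeomorphism_compact[OF compact_Icc c\<sigma> refl inj] by blast
  then have hom: "homeomorphism {a<..<b} {0<..<L} \<sigma> \<tau>"
    by (rule homeomorphism_of_subsets) (use img in auto)
  have "(\<tau> has_real_derivative inverse (w (\<tau> s))) (at s)" if s: "s \<in> {0<..<L}" for s
  proof (rule DERIV_inverse_function[where a = 0 and b = L and f = \<sigma>])
    have \<tau>s: "\<tau> s \<in> {a<..<b}" using hom s unfolding homeomorphism_def by blast
    show "DERIV \<sigma> (\<tau> s) :> w (\<tau> s)" by (rule d\<sigma>'[OF \<tau>s])
    show "w (\<tau> s) \<noteq> 0" using pos[of "\<tau> s"] \<tau>s by auto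
    show "\<sigma> (\<tau> y) = y" if "0 < y" "y < L" for y
      using hom that unfolding homeomorphism_def by auto
    show "isCont \<tau> s"
      using hom s by (auto simp: homeomorphism_def continuous_on_eq_continuous_at)
  qed (use s in auto)
  then show ?thesis
    using that[OF L homeomorphism_symD[OF hom]]
    by (simp add: has_real_derivative_iff_has_vector_derivative)
qed

text \<open>Non-degeneracy speaks only of unit-speed parametrisations, whereas the definition of a curve
  provides arbitrary regular ones. Reparametrising a subarc inside the domain avoids end points:
  its parameter interval is open and its image is still relatively open in \<open>\<Gamma>\<close>.\<close>

lemma local_param_imp_unit_speed_param:
  fixes \<Gamma> :: "(real ^ 'n) set"
  assumes "local_param (Suc k) \<Gamma> \<gamma> I"
  obtains \<beta> L where "0 < L" "unit_speed_param (Suc k) \<Gamma> \<beta> {0<..<L}" "Ck_on (Suc k) \<beta> {0<..<L}"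
proof -
  from assms obtain g J where I: "is_interval I" "interior I \<noteq> {}"
    and op: "openin (top_of_set \<Gamma>) (\<gamma> ` I)" and hom: "homeomorphism I (\<gamma> ` I) \<gamma> g"
    and J: "open J" "I \<subseteq> J" "Ck_on (Suc k) \<gamma> J"
    and nz: "\<And>s. s \<in> I \<Longrightarrow> vector_derivative \<gamma> (at s) \<noteq> 0"
    unfolding local_param_def by blast
  obtain p where "p \<in> interior I" using I(2) by blast
  then obtain e where e: "e > 0" "cball p e \<subseteq> I"
    by (meson interior_subset mem_interior_cball)
  define a b where "a = p - e" and "b = p + e"
  have ab: "a < b" "{a..b} \<subseteq> I" using e by (auto simp: a_def b_def cball_eq_atLeastAtMost)
  define v where "v s = vector_derivative \<gamma> (at s)" for s
  have nzv: "v s \<noteq> 0" if "s \<in> I" for s using nz[OF that] by (simp add: v_def)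
  have d\<gamma>: "(\<gamma> has_vector_derivative v s) (at s)" if "s \<in> J" for s
    unfolding v_def by (rule Ck_on_SucD(1)[OF J(1,3) that])
  have Cv: "Ck_on k v J" unfolding v_def by (rule Ck_on_SucD(2)[OF J(1,3)])
  have abI: "{a<..<b} \<subseteq> I" by (rule subset_trans[OF _ ab(2)]) auto
  have abJ: "{a<..<b} \<subseteq> J" by (rule subset_trans[OF abI J(2)])
  have "continuous_on J v" using Ck_on_iter_continuous[OF Cv, of 0] by simp
  then have "continuous_on {a..b} (\<lambda>s. norm (v s))"
    using ab(2) J(2) by (intro continuous_on_norm) (auto intro: continuous_on_subset)
  moreover have "0 < norm (v t)" if "t \<in> {a..b}" for t
    using nzv[of t] ab(2) that by auto
  ultimately obtain L \<tau> \<sigma> where L: "0 < L" "homeomorphism {0<..<L} {a<..<b} \<tau> \<sigma>"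
    "\<And>s. s \<in> {0<..<L} \<Longrightarrow> (\<tau> has_vector_derivative inverse (norm (v (\<tau> s)))) (at s)"
    using inverse_primitive_exists[OF ab(1), of "\<lambda>s. norm (v s)"] by metis
  have \<tau>: "\<tau> ` {0<..<L} = {a<..<b}" by (rule homeomorphism_image1[OF L(2)])
  define \<beta> where "\<beta> = \<gamma> \<circ> \<tau>"
  have C\<beta>: "Ck_on (Suc k) \<beta> {0<..<L}"
    unfolding \<beta>_def
  proof (rule Ck_on_compose_flow[OF _ _ _ _ _ L(3)])
    show "Ck_on (Suc k - 1) (\<lambda>s. inverse (norm (v s))) {a<..<b}"
      using Ck_on_subset[OF Cv abJ] nzv abI by (auto intro!: Ck_on_inverse_norm)
    show "Ck_on (Suc k) \<gamma> {a<..<b}" by (rule Ck_on_subset[OF J(3) abJ])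
  qed (use \<tau> in auto)
  have d\<beta>: "norm (vector_derivative \<beta> (at s)) = 1" if s: "s \<in> {0<..<L}" for s
  proof -
    have ts: "\<tau> s \<in> {a<..<b}" using \<tau> s by blast
    then have "(\<beta> has_vector_derivative inverse (norm (v (\<tau> s))) *\<^sub>R v (\<tau> s)) (at s)"
      unfolding \<beta>_def using abJ by (intro vector_diff_chain_at L(3) s d\<gamma>) auto
    then have "vector_derivative \<beta> (at s) = inverse (norm (v (\<tau> s))) *\<^sub>R v (\<tau> s)"
      by (rule vector_derivative_at)
    moreover have "v (\<tau> s) \<noteq> 0" using nzv abI ts by blast
    ultimately show ?thesis by simp
  qed
  have img: "\<beta> ` {0<..<L} = \<gamma> ` {a<..<b}" unfolding \<beta>_def image_comp[symmetric] \<tau> ..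
  have "openin (top_of_set (\<gamma> ` I)) (\<gamma> ` {a<..<b})"
    by (rule homeomorphism_imp_open_map[OF hom open_subset[OF abI]]) simp
  then have "openin (top_of_set \<Gamma>) (\<beta> ` {0<..<L})"
    unfolding img using op by (rule openin_trans)
  moreover have "homeomorphism {a<..<b} (\<gamma> ` {a<..<b}) \<gamma> g"
    by (rule homeomorphism_of_subsets[OF hom abI]) auto
  from homeomorphism_compose[OF L(2) this]
  have "homeomorphism {0<..<L} (\<beta> ` {0<..<L}) \<beta> (\<sigma> \<circ> g)"
    unfolding img unfolding \<beta>_def .
  moreover have "vector_derivative \<beta> (at s) \<noteq> 0" if "s \<in> {0<..<L}" for s
    using d\<beta>[OF that] by auto
  ultimately have "unit_speed_param (Suc k) \<Gamma> \<beta> {0<..<L}"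
    unfolding unit_speed_param_def local_param_def
    using L(1) C\<beta> d\<beta> by (auto simp: is_interval_oo interior_open intro!: exI[of _ "{0<..<L}"])
  then show ?thesis using that L(1) C\<beta> by blast
qed

section \<open>Orthogonality and boxes\<close>

lemma unit_orthogonal_exists:
  fixes S :: "(real ^ 'n) set"
  assumes "finite S" "card S < CARD('n)"
  obtains w where "norm w = 1" "\<And>y. y \<in> S \<Longrightarrow> w \<bullet> y = 0"
proof -
  have "dim S < DIM(real ^ 'n)"
    using dim_le_card'[OF assms(1)] assms(2) by simp
  then obtain x where x: "x \<noteq> 0" "\<And>y. y \<in> span S \<Longrightarrow> orthogonal x y"
    using orthogonal_to_subspace_exists by blast
  show ?thesis
  proof
    show "norm (x /\<^sub>R norm x) = 1" using x(1) by simp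
    show "(x /\<^sub>R norm x) \<bullet> y = 0" if "y \<in> S" for y
      using x(2)[OF span_base[OF that]] by (simp add: orthogonal_def)
  qed
qed

lemma idx_range: "idx (j :: 'n::finite) \<in> {1..CARD('n)}"
  using bij_betw_idx by (metis bij_betwE UNIV_I)

lemma idx_eq_iff: "idx (i :: 'n::finite) = idx j \<longleftrightarrow> i = j"
  using bij_betw_idx by (metis bij_betw_imp_inj_on injD)

text \<open>A box has width of order \<open>\<delta> i\<close> in every direction orthogonal to its \<open>i - 1\<close> longest edges.
  These edges and \<open>n - i\<close> further vectors do not span the space, so such a direction can be chosen
  orthogonal to the further vectors as well.\<close>

lemma open_box_thin_direction:
  fixes B :: "(real ^ 'n) set"
  assumes B: "open_box B l" and l: "\<And>j. j \<in> {1..CARD('n)} \<Longrightarrow> l j \<le> \<delta> j"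
    and \<delta>: "\<delta> \<in> Delta CARD('n)" and i: "i \<in> {1..CARD('n)}"
    and V: "finite V" "card V \<le> CARD('n) - i"
  obtains w where "norm w = 1" "\<And>v. v \<in> V \<Longrightarrow> w \<bullet> v = 0"
    "\<And>p q. p \<in> B \<Longrightarrow> q \<in> B \<Longrightarrow> \<bar>(p - q) \<bullet> w\<bar> \<le> real CARD('n) * \<delta> i"
proof -
  obtain f :: "real ^ 'n \<Rightarrow> real ^ 'n" and c where f: "orthogonal_transformation f"
    and Bf: "B = (\<lambda>x. c + f x) ` box 0 (\<chi> j. l (idx j))"
    using B unfolding open_box_def by blast
  define E where "E = (\<lambda>j. f (axis j 1)) ` {j :: 'n. idx j < i}"
  have "card E \<le> card {j :: 'n. idx j < i}" unfolding E_def by (rule card_image_le) simp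
  also have "\<dots> = card (idx ` {j :: 'n. idx j < i})"
    by (rule card_image[symmetric]) (simp add: inj_on_def idx_eq_iff)
  also have "\<dots> \<le> card {1..<i}"
    by (rule card_mono) (use idx_range[where 'n = 'n] in auto)
  finally have cE: "card E \<le> i - 1" by simp
  have "card (E \<union> V) < CARD('n)"
    using card_Un_le[of E V] cE V(2) i by auto
  then obtain w where w: "norm w = 1" "\<And>y. y \<in> E \<union> V \<Longrightarrow> w \<bullet> y = 0"
    using unit_orthogonal_exists[of "E \<union> V"] V(1) by (auto simp: E_def)
  show ?thesis
  proof (rule that[OF w(1)])
    show "w \<bullet> v = 0" if "v \<in> V" for v using w(2) that by simp
    fix p q assume "p \<in> B" "q \<in> B"
    then obtain x y where xy: "p = c + f x" "q = c + f y"
      "x \<in> box 0 (\<chi> j. l (idx j))" "y \<in> box 0 (\<chi> j. l (idx j))"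
      unfolding Bf by blast
    define z where "z = x - y"
    have lin: "linear f" using f by (simp add: orthogonal_transformation_def)
    have z: "\<bar>z $ j\<bar> \<le> \<delta> (idx j)" for j
    proof -
      have "0 < x $ j" "x $ j < l (idx j)" "0 < y $ j" "y $ j < l (idx j)"
        using xy(3,4) by (auto simp: mem_box_cart)
      then show ?thesis using l[OF idx_range, of j] by (simp add: z_def)
    qed
    have "p - q = f z" using xy(1,2) by (simp add: z_def linear_diff[OF lin])
    also have "\<dots> = f (\<Sum>j\<in>UNIV. z $ j *\<^sub>R axis j 1)"
      using basis_expansion[of z] by (simp add: scalar_mult_eq_scaleR)
    also have "\<dots> = (\<Sum>j\<in>UNIV. z $ j *\<^sub>R f (axis j 1))"
      by (simp add: linear_sum[OF lin] linear_scale[OF lin])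
    finally have "(p - q) \<bullet> w = (\<Sum>j\<in>UNIV. z $ j * (f (axis j 1) \<bullet> w))"
      by (simp add: inner_sum_left)
    also have "\<bar>\<dots>\<bar> \<le> (\<Sum>j\<in>(UNIV :: 'n set). \<delta> i)"
    proof (rule order_trans[OF sum_abs], rule sum_mono)
      fix j :: 'n
      show "\<bar>z $ j * (f (axis j 1) \<bullet> w)\<bar> \<le> \<delta> i"
      proof (cases "idx j < i")
        case True
        then have "w \<bullet> f (axis j 1) = 0" by (intro w(2)) (auto simp: E_def)
        then show ?thesis using DeltaD[OF \<delta> i] by (simp add: inner_commute)
      next
        case False
        have "norm (f (axis j 1)) = 1"
          using f by (simp add: orthogonal_transformation)
        then have "\<bar>f (axis j 1) \<bullet> w\<bar> \<le> 1"
          using Cauchy_Schwarz_ineq2[of "f (axis j 1)" w] w(1) by simp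
        then have "\<bar>z $ j\<bar> * \<bar>f (axis j 1) \<bullet> w\<bar> \<le> \<bar>z $ j\<bar> * 1"
          by (intro mult_left_mono) auto
        also have "\<dots> \<le> \<delta> (idx j)" using z by simp
        also have "\<dots> \<le> \<delta> i"
          using Delta_antimono[OF \<delta> i idx_range] False by simp
        finally show ?thesis by (simp add: abs_mult)
      qed
    qed
    also have "\<dots> = real CARD('n) * \<delta> i" by simp
    finally show "\<bar>(p - q) \<bullet> w\<bar> \<le> real CARD('n) * \<delta> i" .
  qed
qed

section \<open>The lower bound\<close>

text \<open>The mean value theorem on every other gap turns \<open>2\<^sup>k\<^sup>+\<^sup>1\<close> separated points where
  the function is small into \<open>2\<^sup>k\<close> separated points where its derivative is small.\<close>

lemma small_derivative_of_small_values:
  fixes f :: "nat \<Rightarrow> real \<Rightarrow> real"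
  assumes "\<And>j s. j < k \<Longrightarrow> s \<in> {a..b} \<Longrightarrow> (f j has_real_derivative f (Suc j) s) (at s)"
    and "\<And>m. m < 2 ^ k \<Longrightarrow> x m \<in> {a..b} \<and> \<bar>f 0 (x m)\<bar> \<le> D"
    and "\<And>m. Suc m < 2 ^ k \<Longrightarrow> x m + h \<le> x (Suc m)"
    and h: "0 < h"
  shows "\<exists>\<xi>\<in>{a..b}. \<bar>f k \<xi>\<bar> \<le> D * (2 / h) ^ k"
  using assms(1-3)
proof (induction k arbitrary: f x D)
  case 0
  then show ?case by force
next
  case (Suc k)
  have "\<exists>y. x (2 * m) \<le> y \<and> y \<le> x (2 * m + 1) \<and> y \<in> {a..b} \<and> \<bar>f 1 y\<bar> \<le> D * (2 / h)"
    if m: "m < 2 ^ k" for m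
  proof -
    have m2: "2 * m < 2 ^ Suc k" "Suc (2 * m) < 2 ^ Suc k" using m by auto
    note p = Suc.prems(2)[OF m2(1)] and q = Suc.prems(2)[OF m2(2)] and g = Suc.prems(3)[OF m2(2)]
    obtain y where y: "x (2 * m) < y" "y < x (Suc (2 * m))"
      "f 0 (x (Suc (2 * m))) - f 0 (x (2 * m)) = (x (Suc (2 * m)) - x (2 * m)) * f 1 y"
      using MVT2[of "x (2 * m)" "x (Suc (2 * m))" "f 0" "f 1"] g h p q Suc.prems(1)[of 0] by auto
    have "h * \<bar>f 1 y\<bar> \<le> \<bar>(x (Suc (2 * m)) - x (2 * m)) * f 1 y\<bar>"
      using g h by (simp add: abs_mult mult_right_mono)
    also have "\<dots> \<le> 2 * D" unfolding y(3)[symmetric] using p q by linarith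
    finally have "\<bar>f 1 y\<bar> \<le> D * (2 / h)" using h by (simp add: field_simps)
    then show ?thesis using y p q by (intro exI[of _ y]) auto
  qed
  then obtain y where y: "\<And>m. m < 2 ^ k \<Longrightarrow>
      x (2 * m) \<le> y m \<and> y m \<le> x (2 * m + 1) \<and> y m \<in> {a..b} \<and> \<bar>f 1 (y m)\<bar> \<le> D * (2 / h)"
    by metis
  have "\<exists>\<xi>\<in>{a..b}. \<bar>(\<lambda>j. f (Suc j)) k \<xi>\<bar> \<le> (D * (2 / h)) * (2 / h) ^ k"
  proof (rule Suc.IH)
    show "y m + h \<le> y (Suc m)" if "Suc m < 2 ^ k" for m
      using y[of m] y[of "Suc m"] Suc.prems(3)[of "2 * m + 1"] that by auto
  qed (use y Suc.prems(1) in auto)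
  then show ?case by (simp add: mult.assoc)
qed

lemma nondegenerate_frame_lower_bound:
  fixes v :: "nat \<Rightarrow> real ^ 'n"
  assumes "det ((\<chi> i j. v (idx j) $ i) :: real ^ 'n ^ 'n) \<noteq> 0"
  obtains \<eta> where "0 < \<eta>" "\<And>w. norm w = 1 \<Longrightarrow> \<exists>k\<in>{1..CARD('n)}. \<eta> \<le> \<bar>v k \<bullet> w\<bar>"
proof -
  define A :: "real ^ 'n ^ 'n" where "A = (\<chi> i j. v (idx j) $ i)"
  have "invertible (transpose A)"
    using assms by (simp add: A_def[symmetric] invertible_det_nz)
  then have "inj ((*v) (transpose A))" by (rule inj_matrix_vector_mult)
  then obtain b where b: "0 < b" "\<And>w. b * norm w \<le> norm (transpose A *v w)"
    using linear_inj_bounded_below_pos[OF matrix_vector_mul_linear] by blast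
  have comp: "(transpose A *v w) $ j = v (idx j) \<bullet> w" for w j
    by (simp add: matrix_vector_mult_def transpose_def A_def inner_vec_def)
  show ?thesis
  proof
    show "0 < b / real CARD('n)" using b(1) by simp
    fix w :: "real ^ 'n" assume w: "norm w = 1"
    show "\<exists>k\<in>{1..CARD('n)}. b / real CARD('n) \<le> \<bar>v k \<bullet> w\<bar>"
    proof (rule ccontr)
      assume "\<not> ?thesis"
      then have "\<bar>(transpose A *v w) $ j\<bar> < b / real CARD('n)" for j
        using idx_range[of j] comp by (metis not_le)
      then have "(\<Sum>j\<in>UNIV. \<bar>(transpose A *v w) $ j\<bar>) < (\<Sum>j\<in>(UNIV::'n set). b / real CARD('n))"
        by (intro sum_strict_mono) auto
      also have "\<dots> = b" by simp
      finally show False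
        using norm_le_l1_cart[of "transpose A *v w"] b(2)[of w] w by simp
    qed
  qed
qed

text \<open>Sample the arc with step \<open>h\<close> comparable to \<open>\<delta> i powr (1/i)\<close>; no box contains more than \<open>2\<^sup>n\<close>
  samples. Indeed, let \<open>w\<close> be a thin direction of the box that is orthogonal to the derivatives of
  order above \<open>i\<close> at \<open>s0\<close>. By non-degeneracy \<open>w\<close> meets a derivative of some order \<open>k \<le> i\<close>, and
  since the arc is short, \<open>iter_vderiv k \<gamma> s \<bullet> w\<close> stays away from 0 along the arc. With \<open>2\<^sup>k\<close>
  samples in the box, the coordinate of \<open>\<gamma>\<close> along \<open>w\<close> varies by at most \<open>n * \<delta> i\<close> on them, so that
  its \<open>k\<close>-th derivative is somewhere as small as \<open>n * \<delta> i * (2/h)\<^sup>k\<close>, a contradiction.\<close>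

lemma covering_card_lower_bound:
  fixes \<gamma> :: "real \<Rightarrow> real ^ 'n"
  assumes ab: "a < b" and s0: "s0 \<in> {a..b}"
    and d: "\<And>j s. j < CARD('n) \<Longrightarrow> s \<in> {a..b} \<Longrightarrow>
      (iter_vderiv j \<gamma> has_vector_derivative iter_vderiv (Suc j) \<gamma> s) (at s)"
    and \<eta>: "0 < \<eta>" "\<And>w. norm w = 1 \<Longrightarrow> \<exists>k\<in>{1..CARD('n)}. \<eta> \<le> \<bar>iter_vderiv k \<gamma> s0 \<bullet> w\<bar>"
    and close: "\<And>k s. k \<in> {1..CARD('n)} \<Longrightarrow> s \<in> {a..b} \<Longrightarrow>
      norm (iter_vderiv k \<gamma> s - iter_vderiv k \<gamma> s0) \<le> \<eta> / 4"
    and \<delta>: "\<delta> \<in> Delta CARD('n)" and i: "i \<in> {1..CARD('n)}"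
    and \<B>: "finite \<B>" "\<gamma> ` {a..b} \<subseteq> \<Union>\<B>"
      "\<And>B. B \<in> \<B> \<Longrightarrow> \<exists>l. open_box B l \<and> (\<forall>j\<in>{1..CARD('n)}. l j \<le> \<delta> j)"
  shows "(b - a) / (2 ^ CARD('n) * (2 + 4 * real CARD('n) / \<eta>)) * \<delta> i powr (- 1 / real i)
    \<le> real (card \<B>)"
proof -
  define n where "n = CARD('n)"
  \<comment> \<open>\<open>K\<close> makes \<open>n * (2/K)\<^sup>k < \<eta>/2\<close> for every \<open>k \<ge> 1\<close>\<close>
  define K where "K = 2 + 4 * real n / \<eta>"
  have K: "2 \<le> K" using \<eta>(1) by (simp add: K_def)
  note \<delta>i = DeltaD[OF \<delta> i]
  define \<epsilon> where "\<epsilon> = \<delta> i powr (1 / real i)"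
  have \<epsilon>: "0 < \<epsilon>" "\<epsilon> \<le> 1" "\<epsilon> ^ i = \<delta> i"
    using \<delta>i i by (auto simp: \<epsilon>_def powr_le1 powr_realpow[symmetric] powr_powr)
  define h where "h = K * \<epsilon>"
  have h: "0 < h" using K \<epsilon> by (simp add: h_def)
  define N where "N = nat \<lfloor>(b - a) / h\<rfloor>"
  define x where "x m = a + real m * h" for m
  have xab: "x m \<in> {a..b}" if "m \<le> N" for m
  proof -
    have "real N \<le> (b - a) / h" unfolding N_def using ab h by (intro of_nat_floor) simp
    then have "real m \<le> (b - a) / h" using that by linarith
    then show ?thesis using h by (simp add: x_def field_simps)
  qed
  have N: "(b - a) / h \<le> real (Suc N)"
    using ab h unfolding N_def by (simp add: of_nat_nat) linarith
  have small: "card {m \<in> {..N}. \<gamma> (x m) \<in> B} \<le> 2 ^ n" if "B \<in> \<B>" for B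
  proof (rule ccontr)
    define S where "S = {m \<in> {..N}. \<gamma> (x m) \<in> B}"
    assume "\<not> ?thesis"
    then have cS: "2 ^ n \<le> card S" by (simp add: S_def)
    have fS: "finite S" by (simp add: S_def)
    obtain g where g: "bij_betw g {..<card S} S" "strict_mono_on {..<card S} g"
      using ex_bij_betw_strict_mono_card[OF fS] by blast
    obtain l where l: "open_box B l" "\<And>j. j \<in> {1..CARD('n)} \<Longrightarrow> l j \<le> \<delta> j"
      using \<B>(3)[OF \<open>B \<in> \<B>\<close>] by blast
    define V where "V = (\<lambda>k. iter_vderiv k \<gamma> s0) ` {i<..n}"
    have "card V \<le> card {i<..n}" unfolding V_def by (rule card_image_le) simp
    then have V: "finite V" "card V \<le> CARD('n) - i" by (auto simp: V_def n_def)
    obtain w where w: "norm w = 1" "\<And>v. v \<in> V \<Longrightarrow> w \<bullet> v = 0"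
      "\<And>p q. p \<in> B \<Longrightarrow> q \<in> B \<Longrightarrow> \<bar>(p - q) \<bullet> w\<bar> \<le> real CARD('n) * \<delta> i"
      using open_box_thin_direction[OF l \<delta> i V] by blast
    obtain k where k: "k \<in> {1..n}" "\<eta> \<le> \<bar>iter_vderiv k \<gamma> s0 \<bullet> w\<bar>"
      using \<eta>(2)[OF w(1)] by (auto simp: n_def)
    have ki: "k \<le> i"
    proof (rule ccontr)
      assume "\<not> k \<le> i"
      then have "w \<bullet> iter_vderiv k \<gamma> s0 = 0" using k(1) by (intro w(2)) (auto simp: V_def)
      then show False using k(2) \<eta>(1) by (simp add: inner_commute)
    qed
    define p where "p = \<gamma> (x (g 0))"
    \<comment> \<open>the coordinate along \<open>w\<close> relative to \<open>p\<close>, and its derivatives\<close>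
    define f where "f j s = iter_vderiv j \<gamma> s \<bullet> w - (if j = 0 then p \<bullet> w else 0)" for j s
    have pow: "(2::nat) ^ k \<le> 2 ^ n" using k(1) by (intro power_increasing) auto
    have gS: "g m \<in> S" if "m < 2 ^ n" for m
      using bij_betwE[OF g(1)] that cS by auto
    have "\<exists>\<xi>\<in>{a..b}. \<bar>f k \<xi>\<bar> \<le> (real n * \<delta> i) * (2 / h) ^ k"
    proof (rule small_derivative_of_small_values[where x = "\<lambda>m. x (g m)"])
      fix j s assume js: "j < k" "s \<in> {a..b}"
      have "(iter_vderiv j \<gamma> has_vector_derivative iter_vderiv (Suc j) \<gamma> s) (at s)"
        using d[of j s] js k(1) by (auto simp: n_def)
      then have "((\<lambda>s. iter_vderiv j \<gamma> s \<bullet> w) has_vector_derivative iter_vderiv (Suc j) \<gamma> s \<bullet> w) (at s)"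
        by (rule bounded_linear.has_vector_derivative[OF bounded_linear_inner_left])
      then show "(f j has_real_derivative f (Suc j) s) (at s)"
        unfolding f_def has_real_derivative_iff_has_vector_derivative[symmetric]
        by (auto intro!: derivative_eq_intros)
    next
      fix m :: nat assume m: "m < 2 ^ k"
      have "g m \<in> S" "g 0 \<in> S" using gS less_le_trans[OF m pow] by auto
      then show "x (g m) \<in> {a..b} \<and> \<bar>f 0 (x (g m))\<bar> \<le> real n * \<delta> i"
        using w(3)[of "\<gamma> (x (g m))" p] xab
        by (auto simp: S_def f_def p_def n_def inner_diff_left)
    next
      fix m :: nat assume "Suc m < 2 ^ k"
      then have "Suc m < card S" using pow cS by linarith
      then have "g m < g (Suc m)" by (intro strict_mono_onD[OF g(2)]) auto
      then have "real (g m) + 1 \<le> real (g (Suc m))" by linarith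
      then have "(real (g m) + 1) * h \<le> real (g (Suc m)) * h"
        using h by (intro mult_right_mono) auto
      then show "x (g m) + h \<le> x (g (Suc m))"
        by (simp add: x_def algebra_simps)
    qed (rule h)
    then obtain \<xi> where \<xi>: "\<xi> \<in> {a..b}" "\<bar>f k \<xi>\<bar> \<le> (real n * \<delta> i) * (2 / h) ^ k" by blast
    have "\<delta> i \<le> \<epsilon> ^ k" unfolding \<epsilon>(3)[symmetric] using \<epsilon> ki by (intro power_decreasing) auto
    then have "(real n * \<delta> i) * (2 / h) ^ k \<le> (real n * \<epsilon> ^ k) * (2 / h) ^ k"
      using h by (intro mult_right_mono mult_left_mono) auto
    also have "\<dots> = real n * (2 / K) ^ k"
      using \<epsilon>(1) by (simp add: h_def power_divide power_mult_distrib)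
    also have "\<dots> \<le> real n * (2 / K) ^ 1"
      using K k(1) by (intro mult_left_mono power_decreasing) auto
    also have "\<dots> < \<eta> / 2"
      using \<eta>(1) by (simp add: K_def field_simps add_pos_nonneg)
    finally have fk: "\<bar>f k \<xi>\<bar> < \<eta> / 2" using \<xi>(2) by simp
    have "\<bar>(iter_vderiv k \<gamma> \<xi> - iter_vderiv k \<gamma> s0) \<bullet> w\<bar> \<le> \<eta> / 4"
      using Cauchy_Schwarz_ineq2[of "iter_vderiv k \<gamma> \<xi> - iter_vderiv k \<gamma> s0" w] w(1)
        close[of k \<xi>] k(1) \<xi>(1) by (simp add: n_def)
    moreover have "f k \<xi> = iter_vderiv k \<gamma> \<xi> \<bullet> w" using k(1) by (simp add: f_def)
    ultimately show False
      using fk k(2) \<eta>(1) unfolding inner_diff_left by linarith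
  qed
  have "{..N} \<subseteq> (\<Union>B\<in>\<B>. {m \<in> {..N}. \<gamma> (x m) \<in> B})"
    using \<B>(2) xab by (auto simp: image_subset_iff)
  then have "Suc N \<le> card (\<Union>B\<in>\<B>. {m \<in> {..N}. \<gamma> (x m) \<in> B})"
    using card_mono[of "\<Union>B\<in>\<B>. {m \<in> {..N}. \<gamma> (x m) \<in> B}" "{..N}"] \<B>(1) by simp
  also have "\<dots> \<le> (\<Sum>B\<in>\<B>. card {m \<in> {..N}. \<gamma> (x m) \<in> B})"
    by (rule card_UN_le[OF \<B>(1)])
  also have "\<dots> \<le> (\<Sum>B\<in>\<B>. 2 ^ n)" by (rule sum_mono[OF small])
  finally have "real (Suc N) \<le> real (card \<B> * 2 ^ n)" by (simp only: of_nat_le_iff) simp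
  then have "(b - a) / h \<le> real (card \<B>) * 2 ^ n" using N by simp
  then have "(b - a) / (2 ^ n * K) * (1 / \<epsilon>) \<le> real (card \<B>)"
    using K \<epsilon>(1) unfolding h_def by (simp add: field_simps)
  moreover have "\<delta> i powr (- 1 / real i) = 1 / \<epsilon>" by (simp add: \<epsilon>_def powr_minus_divide)
  ultimately show ?thesis unfolding K_def n_def by simp
qed

text \<open>A single short arc already needs this many boxes, so the whole curve does.\<close>

lemma nondegenerate_curve_covering_lower_bound:
  fixes \<Gamma> :: "(real ^ 'n) set"
  assumes "nondegenerate_curve \<Gamma>"
  obtains c where "0 < c" "\<And>\<delta> \<B>. \<delta> \<in> Delta CARD('n) \<Longrightarrow> finite \<B> \<Longrightarrow> \<Gamma> \<subseteq> \<Union>\<B> \<Longrightarrow>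
    (\<And>B. B \<in> \<B> \<Longrightarrow> \<exists>l. open_box B l \<and> (\<forall>j\<in>{1..CARD('n)}. l j \<le> \<delta> j)) \<Longrightarrow>
    c * scale_count CARD('n) \<delta> \<le> real (card \<B>)"
proof -
  let ?n = "CARD('n)"
  from assms obtain \<gamma>0 I where "local_param (Suc ?n) \<Gamma> \<gamma>0 I"
    unfolding nondegenerate_curve_def compact_embedded_curve_def by fastforce
  then obtain \<gamma> L where L: "0 < L" and us: "unit_speed_param (Suc ?n) \<Gamma> \<gamma> {0<..<L}"
    and C: "Ck_on (Suc ?n) \<gamma> {0<..<L}"
    by (rule local_param_imp_unit_speed_param)
  define s0 where "s0 = L / 2"
  have s0: "s0 \<in> {0<..<L}" using L by (simp add: s0_def)
  have "det ((\<chi> i j. iter_vderiv (idx j) \<gamma> s0 $ i) :: real ^ 'n ^ 'n) \<noteq> 0"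
    using assms us s0 unfolding nondegenerate_curve_def by simp
  then obtain \<eta> where \<eta>: "0 < \<eta>"
    "\<And>w. norm w = 1 \<Longrightarrow> \<exists>k\<in>{1..?n}. \<eta> \<le> \<bar>iter_vderiv k \<gamma> s0 \<bullet> w\<bar>"
    using nondegenerate_frame_lower_bound[where v = "\<lambda>k. iter_vderiv k \<gamma> s0"] by metis
  have "eventually (\<lambda>s. norm (iter_vderiv k \<gamma> s - iter_vderiv k \<gamma> s0) \<le> \<eta> / 4) (nhds s0)"
    if "k \<in> {1..?n}" for k
  proof -
    have "continuous_on {0<..<L} (iter_vderiv k \<gamma>)"
      using that by (intro Ck_on_iter_continuous[OF C]) auto
    then have "isCont (iter_vderiv k \<gamma>) s0" using s0 by (simp add: continuous_on_eq_continuous_at)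
    then have "(iter_vderiv k \<gamma> \<longlongrightarrow> iter_vderiv k \<gamma> s0) (nhds s0)"
      by (simp add: isCont_def tendsto_at_iff_tendsto_nhds)
    then have "eventually (\<lambda>s. dist (iter_vderiv k \<gamma> s) (iter_vderiv k \<gamma> s0) < \<eta> / 4) (nhds s0)"
      using \<eta>(1) by (intro tendstoD) auto
    then show ?thesis by (rule eventually_mono) (simp add: dist_norm)
  qed
  then have "eventually (\<lambda>s. \<forall>k\<in>{1..?n}. norm (iter_vderiv k \<gamma> s - iter_vderiv k \<gamma> s0) \<le> \<eta> / 4) (nhds s0)"
    by (intro eventually_ball_finite) auto
  moreover have "eventually (\<lambda>s. s \<in> {0<..<L}) (nhds s0)"
    by (rule eventually_nhds_in_open) (use s0 in auto)
  ultimately have "eventually (\<lambda>s. s \<in> {0<..<L} \<and>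
      (\<forall>k\<in>{1..?n}. norm (iter_vderiv k \<gamma> s - iter_vderiv k \<gamma> s0) \<le> \<eta> / 4)) (nhds s0)"
    by eventually_elim blast
  then obtain e where e: "0 < e" "\<And>s. dist s s0 < e \<Longrightarrow> s \<in> {0<..<L} \<and>
      (\<forall>k\<in>{1..?n}. norm (iter_vderiv k \<gamma> s - iter_vderiv k \<gamma> s0) \<le> \<eta> / 4)"
    unfolding eventually_nhds_metric by blast
  define a b where "a = s0 - e / 2" and "b = s0 + e / 2"
  have ab: "a < b" "s0 \<in> {a..b}" using e(1) by (auto simp: a_def b_def)
  have near: "s \<in> {0<..<L}" "\<And>k. k \<in> {1..?n} \<Longrightarrow> norm (iter_vderiv k \<gamma> s - iter_vderiv k \<gamma> s0) \<le> \<eta> / 4"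
    if "s \<in> {a..b}" for s
  proof -
    have "dist s s0 < e" using that e(1) by (auto simp: a_def b_def dist_real_def)
    from e(2)[OF this] show "s \<in> {0<..<L}"
      "\<And>k. k \<in> {1..?n} \<Longrightarrow> norm (iter_vderiv k \<gamma> s - iter_vderiv k \<gamma> s0) \<le> \<eta> / 4" by auto
  qed
  have "\<gamma> ` {0<..<L} \<subseteq> \<Gamma>"
    using us openin_imp_subset unfolding unit_speed_param_def local_param_def by blast
  then have sub: "\<gamma> ` {a..b} \<subseteq> \<Gamma>" using near(1) by blast
  show ?thesis
  proof
    show "0 < (b - a) / (2 ^ ?n * (2 + 4 * real ?n / \<eta>))"
      using ab(1) \<eta>(1) by (auto intro!: divide_pos_pos mult_pos_pos add_pos_nonneg)
    fix \<delta> and \<B> :: "(real ^ 'n) set set"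
    assume \<delta>: "\<delta> \<in> Delta ?n" and \<B>: "finite \<B>" "\<Gamma> \<subseteq> \<Union>\<B>"
      "\<And>B. B \<in> \<B> \<Longrightarrow> \<exists>l. open_box B l \<and> (\<forall>j\<in>{1..?n}. l j \<le> \<delta> j)"
    have "1 \<le> ?n" by (simp add: Suc_leI)
    then obtain i where i: "i \<in> {1..?n}" "scale_count ?n \<delta> = \<delta> i powr (- 1 / real i)"
      by (rule scale_count_attained)
    show "(b - a) / (2 ^ ?n * (2 + 4 * real ?n / \<eta>)) * scale_count ?n \<delta> \<le> real (card \<B>)"
      unfolding i(2)
      by (rule covering_card_lower_bound[OF ab _ \<eta> _ \<delta> i(1) \<B>(1) _ \<B>(3)])
        (use near sub \<B>(2) in \<open>auto intro!: Ck_on_iter_has_vector_derivative[OF C]\<close>)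
  qed
qed

section \<open>The upper bound\<close>

text \<open>When the frame is built from its last vector to its first, \<open>e i\<close> has to be orthogonal to
  \<open>n - i\<close> vectors already chosen and to \<open>v 1, \<dots>, v (i - 1)\<close>. These \<open>n - 1\<close> vectors leave a
  direction free.\<close>

lemma adapted_orthonormal_frame_exists:
  fixes v :: "nat \<Rightarrow> real ^ 'n"
  obtains e :: "nat \<Rightarrow> real ^ 'n" where
    "\<And>i. i \<in> {1..CARD('n)} \<Longrightarrow> norm (e i) = 1"
    "\<And>i j. i \<in> {1..CARD('n)} \<Longrightarrow> j \<in> {1..CARD('n)} \<Longrightarrow> i \<noteq> j \<Longrightarrow> e i \<bullet> e j = 0"
    "\<And>i j. i \<in> {1..CARD('n)} \<Longrightarrow> j \<in> {1..<i} \<Longrightarrow> e i \<bullet> v j = 0"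
proof -
  define n where "n = CARD('n)"
  have "\<exists>e :: nat \<Rightarrow> real ^ 'n. (\<forall>i\<in>{n-m<..n}. norm (e i) = 1) \<and>
      (\<forall>i\<in>{n-m<..n}. \<forall>j\<in>{n-m<..n}. i \<noteq> j \<longrightarrow> e i \<bullet> e j = 0) \<and>
      (\<forall>i\<in>{n-m<..n}. \<forall>j\<in>{1..<i}. e i \<bullet> v j = 0)" if "m \<le> n" for m
    using that
  proof (induction m)
    case 0
    then show ?case by auto
  next
    case (Suc m)
    then obtain e :: "nat \<Rightarrow> real ^ 'n" where e: "\<forall>i\<in>{n-m<..n}. norm (e i) = 1"
      "\<forall>i\<in>{n-m<..n}. \<forall>j\<in>{n-m<..n}. i \<noteq> j \<longrightarrow> e i \<bullet> e j = 0"
      "\<forall>i\<in>{n-m<..n}. \<forall>j\<in>{1..<i}. e i \<bullet> v j = 0" by auto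
    define p where "p = n - m"
    have p: "1 \<le> p" "p \<le> n" using Suc.prems by (auto simp: p_def)
    have new: "{n - Suc m<..n} = insert p {p<..n}" using Suc.prems by (auto simp: p_def)
    have "card (e ` {p<..n} \<union> v ` {1..<p}) \<le> card {p<..n} + card {1..<p}"
      by (rule order_trans[OF card_Un_le add_mono[OF card_image_le card_image_le]]) auto
    also have "\<dots> < n" using p by auto
    finally obtain w where w: "norm w = 1" "\<And>y. y \<in> e ` {p<..n} \<union> v ` {1..<p} \<Longrightarrow> w \<bullet> y = 0"
      unfolding n_def using unit_orthogonal_exists[of "e ` {p<..CARD('n)} \<union> v ` {1..<p}"] by auto
    show ?case
      unfolding new
      by (rule exI[of _ "e(p := w)"])
        (use e w in \<open>auto simp: p_def[symmetric] inner_commute[of _ w]\<close>)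
  qed
  from this[of n] obtain e :: "nat \<Rightarrow> real ^ 'n" where
    "\<forall>i\<in>{0<..n}. norm (e i) = 1"
    "\<forall>i\<in>{0<..n}. \<forall>j\<in>{0<..n}. i \<noteq> j \<longrightarrow> e i \<bullet> e j = 0"
    "\<forall>i\<in>{0<..n}. \<forall>j\<in>{1..<i}. e i \<bullet> v j = 0" by auto
  then show ?thesis by (intro that[of e]) (auto simp: n_def)
qed

text \<open>The orthogonal map sends the coordinate axes to the frame \<open>e\<close>; the corner of the box is placed
  so that its centre is \<open>p\<close>.\<close>

lemma open_box_around:
  fixes e :: "nat \<Rightarrow> real ^ 'n"
  assumes e1: "\<And>i. i \<in> {1..CARD('n)} \<Longrightarrow> norm (e i) = 1"
    and e0: "\<And>i j. i \<in> {1..CARD('n)} \<Longrightarrow> j \<in> {1..CARD('n)} \<Longrightarrow> i \<noteq> j \<Longrightarrow> e i \<bullet> e j = 0"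
    and \<delta>: "\<delta> \<in> Delta CARD('n)"
  obtains B where "open_box B \<delta>"
    "\<And>q. (\<And>i. i \<in> {1..CARD('n)} \<Longrightarrow> \<bar>(q - p) \<bullet> e i\<bar> < \<delta> i / 2) \<Longrightarrow> q \<in> B"
proof -
  define f where "f x = (\<Sum>j\<in>UNIV. x $ j *\<^sub>R e (idx j))" for x :: "real ^ 'n"
  have ee: "e (idx i) \<bullet> e (idx j) = (if i = j then 1 else 0)" for i j :: 'n
    using e0[OF idx_range idx_range, of i j] e1[OF idx_range, of i]
    by (auto simp: idx_eq_iff norm_eq_1)
  have fe: "f x \<bullet> e (idx j) = x $ j" for x j
    by (simp add: f_def inner_sum_left ee if_distrib cong: if_cong)
  have lin: "linear f"
    by (rule linearI) (simp_all add: f_def scaleR_add_left sum.distrib scaleR_sum_right)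
  have "f x \<bullet> f y = x \<bullet> y" for x y
  proof -
    have "f x \<bullet> f y = (\<Sum>j\<in>UNIV. y $ j * (f x \<bullet> e (idx j)))"
      unfolding f_def[of y] by (simp add: inner_sum_right)
    also have "\<dots> = (\<Sum>j\<in>UNIV. x $ j * y $ j)" by (simp add: fe mult.commute)
    also have "\<dots> = x \<bullet> y" by (simp add: inner_vec_def)
    finally show ?thesis .
  qed
  then have orth: "orthogonal_transformation f" using lin by (simp add: orthogonal_transformation_def)
  define h :: "real ^ 'n" where "h = (\<chi> j. \<delta> (idx j) / 2)"
  define c where "c = p - f h"
  show ?thesis
  proof
    show "open_box ((\<lambda>x. c + f x) ` box 0 (\<chi> i. \<delta> (idx i))) \<delta>"
      unfolding open_box_def using \<delta> orth by (auto simp: Delta_def PiE_iff)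
    fix q assume q: "\<And>i. i \<in> {1..CARD('n)} \<Longrightarrow> \<bar>(q - p) \<bullet> e i\<bar> < \<delta> i / 2"
    obtain x where x: "f x = q - p"
      using orthogonal_transformation_surj[OF orth] by (metis surjD)
    have "\<bar>x $ j\<bar> < \<delta> (idx j) / 2" for j
      using q[OF idx_range, of j] by (simp add: x[symmetric] fe)
    then have "x + h \<in> box 0 (\<chi> i. \<delta> (idx i))"
      by (auto simp: mem_box_cart h_def abs_less_iff) (smt (verit, best) field_sum_of_halves)+
    moreover have "q = c + f (x + h)" by (simp add: c_def linear_add[OF lin] x)
    ultimately show "q \<in> (\<lambda>x. c + f x) ` box 0 (\<chi> i. \<delta> (idx i))" by blast
  qed
qed

text \<open>In a frame adapted to the derivatives at \<open>s\<close>, the Taylor expansion of the \<open>i\<close>-th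
  coordinate starts at order \<open>i\<close>, so a segment of length \<open>h\<close> deviates by at most \<open>M h\<^sup>i\<close> in it. The
  factor 4 makes this less than half the side length.\<close>

lemma short_arc_in_open_box:
  fixes \<gamma> :: "real \<Rightarrow> real ^ 'n"
  assumes d: "\<And>j t. j < CARD('n) \<Longrightarrow> t \<in> {a..b} \<Longrightarrow>
      (iter_vderiv j \<gamma> has_vector_derivative iter_vderiv (Suc j) \<gamma> t) (at t)"
    and M: "1 \<le> M" "\<And>j t. j \<in> {1..CARD('n)} \<Longrightarrow> t \<in> {a..b} \<Longrightarrow> norm (iter_vderiv j \<gamma> t) \<le> M"
    and \<delta>: "\<delta> \<in> Delta CARD('n)" and s: "s \<in> {a..b}"
    and h: "0 < h" "4 * M * h * scale_count CARD('n) \<delta> \<le> 1"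
  obtains B where "open_box B \<delta>" "\<gamma> ` ({s..s + h} \<inter> {a..b}) \<subseteq> B"
proof -
  obtain e :: "nat \<Rightarrow> real ^ 'n" where
    e: "\<And>i. i \<in> {1..CARD('n)} \<Longrightarrow> norm (e i) = 1"
      "\<And>i j. i \<in> {1..CARD('n)} \<Longrightarrow> j \<in> {1..CARD('n)} \<Longrightarrow> i \<noteq> j \<Longrightarrow> e i \<bullet> e j = 0"
    and ev: "\<And>i j. i \<in> {1..CARD('n)} \<Longrightarrow> j \<in> {1..<i} \<Longrightarrow> e i \<bullet> iter_vderiv j \<gamma> s = 0"
    using adapted_orthonormal_frame_exists[of "\<lambda>j. iter_vderiv j \<gamma> s"] by metis
  obtain B where B: "open_box B \<delta>"
    "\<And>q. (\<And>i. i \<in> {1..CARD('n)} \<Longrightarrow> \<bar>(q - \<gamma> s) \<bullet> e i\<bar> < \<delta> i / 2) \<Longrightarrow> q \<in> B"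
    using open_box_around[where e = e and p = "\<gamma> s", OF e \<delta>] by blast
  have "\<bar>(\<gamma> x - \<gamma> s) \<bullet> e i\<bar> < \<delta> i / 2"
    if x: "x \<in> {s..s + h} \<inter> {a..b}" and i: "i \<in> {1..CARD('n)}" for x i
  proof (cases "x = s")
    case False
    define f where "f j t = iter_vderiv j \<gamma> t \<bullet> e i" for j t
    have df: "(f j has_real_derivative f (Suc j) t) (at t)" if "j < i" "t \<in> {a..b}" for j t
    proof -
      have "(iter_vderiv j \<gamma> has_vector_derivative iter_vderiv (Suc j) \<gamma> t) (at t)"
        using d[of j t] that i by auto
      then show ?thesis
        unfolding f_def has_real_derivative_iff_has_vector_derivative
        by (rule bounded_linear.has_vector_derivative[OF bounded_linear_inner_left])
    qed
    have "\<exists>t. (if x < s then x < t \<and> t < s else s < t \<and> t < x) \<and>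
        f 0 x = (\<Sum>m<i. (f m s / fact m) * (x - s) ^ m) + (f i t / fact i) * (x - s) ^ i"
      by (rule Taylor[of i f "f 0" a b]) (use i x s False df in auto)
    then obtain t where t: "s < t" "t < x"
      "f 0 x = (\<Sum>m<i. (f m s / fact m) * (x - s) ^ m) + (f i t / fact i) * (x - s) ^ i"
      using x by auto
    have "(\<Sum>m<i. (f m s / fact m) * (x - s) ^ m) = (\<Sum>m<i. if m = 0 then f 0 s else 0)"
      using ev[OF i] by (intro sum.cong) (auto simp: f_def inner_commute)
    also have "\<dots> = f 0 s" using i by (simp add: sum.delta)
    finally have coord: "(\<gamma> x - \<gamma> s) \<bullet> e i = (f i t / fact i) * (x - s) ^ i"
      using t(3) by (simp add: f_def inner_diff_left)
    have "\<bar>f i t\<bar> \<le> M"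
    proof -
      have "\<bar>f i t\<bar> \<le> norm (iter_vderiv i \<gamma> t) * norm (e i)"
        unfolding f_def by (rule Cauchy_Schwarz_ineq2)
      also have "\<dots> \<le> M" using e(1)[OF i] M(2)[OF i, of t] t s x by auto
      finally show ?thesis .
    qed
    moreover have "M * 1 \<le> M * fact i"
      using M(1) by (intro mult_left_mono fact_ge_1) simp
    ultimately have "\<bar>f i t / fact i\<bar> \<le> M"
      by (simp add: abs_divide pos_divide_le_eq)
    moreover have "\<bar>(x - s) ^ i\<bar> \<le> h ^ i"
      using x by (auto simp: power_abs intro: power_mono)
    ultimately have "\<bar>f i t / fact i\<bar> * \<bar>(x - s) ^ i\<bar> \<le> M * h ^ i"
      using M(1) by (intro mult_mono) simp_all
    then have "\<bar>(\<gamma> x - \<gamma> s) \<bullet> e i\<bar> \<le> M * h ^ i"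
      unfolding coord abs_mult .
    also have "\<dots> < \<delta> i / 2"
    proof -
      note \<delta>i = DeltaD[OF \<delta> i]
      have "(4 * M * h) * \<delta> i powr (- 1 / real i) \<le> 1"
        using h M(1) scale_count_ge[OF i, of \<delta>]
        by (elim order_trans[rotated], intro mult_left_mono) auto
      then have "4 * M * h \<le> \<delta> i powr (1 / real i)"
        using \<delta>i by (simp add: powr_minus_divide field_simps)
      then have "(4 * M * h) ^ i \<le> (\<delta> i powr (1 / real i)) ^ i"
        using M(1) h by (intro power_mono) auto
      also have "\<dots> = \<delta> i"
        using \<delta>i i by (simp add: powr_realpow[symmetric] powr_powr)
      finally have "(4 * M) ^ i * h ^ i \<le> \<delta> i" by (simp add: power_mult_distrib)
      moreover have "(4 * M) ^ 1 \<le> (4 * M) ^ i"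
        using i M(1) by (intro power_increasing) auto
      then have "(4 * M) * h ^ i \<le> (4 * M) ^ i * h ^ i"
        using h by (intro mult_right_mono) auto
      ultimately have "4 * (M * h ^ i) \<le> \<delta> i" by simp
      then show ?thesis using \<delta>i by linarith
    qed
    finally show ?thesis .
  qed (use DeltaD[OF \<delta> i] in simp)
  then show ?thesis using B by (intro that[OF B(1)]) blast
qed

lemma arc_covering_upper_bound:
  fixes \<gamma> :: "real \<Rightarrow> real ^ 'n"
  assumes ab: "a \<le> b"
    and d: "\<And>j t. j < CARD('n) \<Longrightarrow> t \<in> {a..b} \<Longrightarrow>
      (iter_vderiv j \<gamma> has_vector_derivative iter_vderiv (Suc j) \<gamma> t) (at t)"
    and cont: "\<And>j. j \<in> {1..CARD('n)} \<Longrightarrow> continuous_on {a..b} (iter_vderiv j \<gamma>)"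
  obtains C where "0 < C" "\<And>\<delta>. \<delta> \<in> Delta CARD('n) \<Longrightarrow> \<exists>\<B>. finite \<B> \<and> \<gamma> ` {a..b} \<subseteq> \<Union>\<B> \<and>
    (\<forall>B\<in>\<B>. open_box B \<delta>) \<and> real (card \<B>) \<le> C * scale_count CARD('n) \<delta>"
proof -
  let ?n = "CARD('n)"
  have "bounded (\<Union>j\<in>{1..?n}. iter_vderiv j \<gamma> ` {a..b})"
    using cont by (intro bounded_UN ballI compact_imp_bounded compact_continuous_image) auto
  then obtain M0 where M0: "\<And>j t. j \<in> {1..?n} \<Longrightarrow> t \<in> {a..b} \<Longrightarrow> norm (iter_vderiv j \<gamma> t) \<le> M0"
    unfolding bounded_iff by blast
  define M where "M = max 1 M0"
  have M: "1 \<le> M" "\<And>j t. j \<in> {1..?n} \<Longrightarrow> t \<in> {a..b} \<Longrightarrow> norm (iter_vderiv j \<gamma> t) \<le> M"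
    using M0 by (auto simp: M_def le_max_iff_disj)
  have "\<exists>\<B>. finite \<B> \<and> \<gamma> ` {a..b} \<subseteq> \<Union>\<B> \<and>
      (\<forall>B\<in>\<B>. open_box B \<delta>) \<and> real (card \<B>) \<le> ((b - a) * (4 * M) + 1) * scale_count ?n \<delta>"
    if \<delta>: "\<delta> \<in> Delta ?n" for \<delta>
  proof -
    define S where "S = scale_count ?n \<delta>"
    have S: "1 \<le> S" unfolding S_def by (rule scale_count_ge_1[OF _ \<delta>]) (simp add: Suc_leI)
    define h where "h = 1 / (4 * M * S)"
    have h: "0 < h" "4 * M * h * S \<le> 1" using M(1) S by (auto simp: h_def field_simps)
    define N where "N = nat \<lfloor>(b - a) / h\<rfloor>"
    have N: "real N \<le> (b - a) / h" unfolding N_def using ab h by (intro of_nat_floor) simp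
    have in_ab: "a + real m * h \<in> {a..b}" if "m \<le> N" for m
    proof -
      have "real m \<le> (b - a) / h" using that N by linarith
      then show ?thesis using h by (simp add: field_simps)
    qed
    have "\<exists>B. open_box B \<delta> \<and> \<gamma> ` ({a + real m * h..a + real m * h + h} \<inter> {a..b}) \<subseteq> B" if "m \<le> N" for m
      using short_arc_in_open_box[OF d M \<delta> in_ab[OF that] h(1)] h(2) unfolding S_def by metis
    then obtain B where B: "\<And>m. m \<le> N \<Longrightarrow> open_box (B m) \<delta> \<and>
        \<gamma> ` ({a + real m * h..a + real m * h + h} \<inter> {a..b}) \<subseteq> B m" by metis
    have "\<gamma> ` {a..b} \<subseteq> \<Union>(B ` {..N})"
    proof
      fix y assume "y \<in> \<gamma> ` {a..b}"
      then obtain t where t: "t \<in> {a..b}" "y = \<gamma> t" by blast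
      define m where "m = nat \<lfloor>(t - a) / h\<rfloor>"
      have ta: "0 \<le> (t - a) / h" using t h by simp
      have "(t - a) / h \<le> (b - a) / h" using t h by (simp add: divide_right_mono)
      then have "m \<le> N" unfolding m_def N_def by (intro nat_mono floor_mono)
      have "real m \<le> (t - a) / h" "(t - a) / h \<le> real m + 1"
        using ta unfolding m_def by (simp_all add: of_nat_nat)
      then have "t \<in> {a + real m * h..a + real m * h + h}" using h by (simp add: field_simps)
      then have "y \<in> B m" using B[OF \<open>m \<le> N\<close>] t by blast
      then show "y \<in> \<Union>(B ` {..N})" using \<open>m \<le> N\<close> by blast
    qed
    moreover have "real (card (B ` {..N})) \<le> ((b - a) * (4 * M) + 1) * S"
    proof -
      have "real (card (B ` {..N})) \<le> real (card {..N})"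
        by (simp only: of_nat_le_iff) (rule card_image_le, simp)
      also have "\<dots> \<le> (b - a) / h + 1" using N by simp
      also have "\<dots> \<le> ((b - a) * (4 * M) + 1) * S"
        using S by (simp add: h_def algebra_simps)
      finally show ?thesis .
    qed
    ultimately show ?thesis
      using B unfolding S_def by (intro exI[of _ "B ` {..N}"]) auto
  qed
  moreover have "0 < (b - a) * (4 * M) + 1"
    using ab M(1) by (intro add_nonneg_pos mult_nonneg_nonneg) auto
  ultimately show ?thesis using that by blast
qed

text \<open>Around the parameter of a point, the image of a closed parameter interval contains a
  neighbourhood in \<open>\<Gamma>\<close>; at a boundary point that interval reaches into the domain of the
  extension, which only enlarges the image.\<close>

lemma compact_embedded_curve_covering_upper_bound:
  fixes \<Gamma> :: "(real ^ 'n) set"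
  assumes "compact_embedded_curve (CARD('n)) \<Gamma>"
  obtains C where "0 < C" "\<And>\<delta>. \<delta> \<in> Delta CARD('n) \<Longrightarrow> \<exists>\<B>. finite \<B> \<and> \<Gamma> \<subseteq> \<Union>\<B> \<and>
    (\<forall>B\<in>\<B>. open_box B \<delta>) \<and> real (card \<B>) \<le> C * scale_count CARD('n) \<delta>"
proof -
  let ?n = "CARD('n)"
  define coverable where "coverable A C \<longleftrightarrow> 0 < C \<and> (\<forall>\<delta>\<in>Delta ?n. \<exists>\<B>. finite \<B> \<and> A \<subseteq> \<Union>\<B> \<and>
    (\<forall>B\<in>\<B>. open_box B \<delta>) \<and> real (card \<B>) \<le> C * scale_count ?n \<delta>)" for A :: "(real ^ 'n) set" and C
  have "\<exists>U C. p \<in> U \<and> openin (top_of_set \<Gamma>) U \<and> coverable U C" if p: "p \<in> \<Gamma>" for p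
  proof -
    from assms p obtain \<gamma> I where lp: "local_param ?n \<Gamma> \<gamma> I" and pI: "p \<in> \<gamma> ` I"
      unfolding compact_embedded_curve_def by blast
    from lp obtain g J where op: "openin (top_of_set \<Gamma>) (\<gamma> ` I)"
      and hom: "homeomorphism I (\<gamma> ` I) \<gamma> g"
      and J: "open J" "I \<subseteq> J" "Ck_on ?n \<gamma> J"
      unfolding local_param_def by (elim conjE exE)
    from pI obtain s where s: "s \<in> I" "p = \<gamma> s" by blast
    then obtain r where r: "0 < r" "cball s r \<subseteq> J" using J(1,2) open_contains_cball by blast
    have Jr: "t \<in> J" if "t \<in> {s - r..s + r}" for t
      using r(2) that by (auto simp: cball_eq_atLeastAtMost)
    obtain C where C: "0 < C" "\<And>\<delta>. \<delta> \<in> Delta ?n \<Longrightarrow> \<exists>\<B>. finite \<B> \<and> \<gamma> ` {s - r..s + r} \<subseteq> \<Union>\<B> \<and>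
        (\<forall>B\<in>\<B>. open_box B \<delta>) \<and> real (card \<B>) \<le> C * scale_count ?n \<delta>"
    proof (rule arc_covering_upper_bound[of "s - r" "s + r" \<gamma>])
      show "continuous_on {s - r..s + r} (iter_vderiv j \<gamma>)" if "j \<in> {1..?n}" for j
        by (rule continuous_on_subset[OF Ck_on_iter_continuous[OF J(3)]]) (use that Jr in auto)
    qed (use r Jr in \<open>auto intro: Ck_on_iter_has_vector_derivative[OF J(3)]\<close>)
    define U where "U = \<gamma> ` (I \<inter> {s - r<..<s + r})"
    have "openin (top_of_set (\<gamma> ` I)) U"
      unfolding U_def by (rule homeomorphism_imp_open_map[OF hom]) (simp add: openin_open_Int)
    then have openU: "openin (top_of_set \<Gamma>) U" using op by (rule openin_trans)
    have pU: "p \<in> U" using s r(1) by (auto simp: U_def)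
    have sub: "U \<subseteq> \<gamma> ` {s - r..s + r}" unfolding U_def by (intro image_mono) auto
    have "coverable U C"
      unfolding coverable_def
    proof (intro conjI ballI C(1))
      fix \<delta> assume "\<delta> \<in> Delta ?n"
      from C(2)[OF this] obtain \<B> where \<B>: "finite \<B>" "\<gamma> ` {s - r..s + r} \<subseteq> \<Union>\<B>"
        "\<forall>B\<in>\<B>. open_box B \<delta>" "real (card \<B>) \<le> C * scale_count ?n \<delta>" by (elim exE conjE)
      show "\<exists>\<B>. finite \<B> \<and> U \<subseteq> \<Union>\<B> \<and> (\<forall>B\<in>\<B>. open_box B \<delta>) \<and>
          real (card \<B>) \<le> C * scale_count ?n \<delta>"
        by (rule exI[of _ \<B>]) (intro conjI \<B> subset_trans[OF sub \<B>(2)])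
    qed
    with pU openU show ?thesis by (intro exI[of _ U] exI[of _ C] conjI)
  qed
  then obtain U C where UC: "\<And>p. p \<in> \<Gamma> \<Longrightarrow> p \<in> U p \<and> openin (top_of_set \<Gamma>) (U p) \<and> coverable (U p) (C p)"
    by metis
  have "compact \<Gamma>" using assms by (simp add: compact_embedded_curve_def)
  moreover have "\<forall>c\<in>U ` \<Gamma>. openin (top_of_set \<Gamma>) c" using UC by blast
  moreover have "\<Gamma> \<subseteq> \<Union>(U ` \<Gamma>)" using UC by blast
  ultimately obtain D where D: "D \<subseteq> U ` \<Gamma>" "finite D" "\<Gamma> \<subseteq> \<Union>D"
    unfolding compact_eq_openin_cover by metis
  then obtain P where P: "P \<subseteq> \<Gamma>" "finite P" "D = U ` P" by (meson finite_subset_image)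
  have "\<Gamma> \<noteq> {}" using assms by (simp add: compact_embedded_curve_def)
  then have "P \<noteq> {}" using D(3) P(3) by auto
  have "\<exists>\<B>. finite \<B> \<and> \<Gamma> \<subseteq> \<Union>\<B> \<and> (\<forall>B\<in>\<B>. open_box B \<delta>) \<and>
      real (card \<B>) \<le> (\<Sum>p\<in>P. C p) * scale_count ?n \<delta>" if \<delta>: "\<delta> \<in> Delta ?n" for \<delta>
  proof -
    have "\<forall>p\<in>P. \<exists>\<B>. finite \<B> \<and> U p \<subseteq> \<Union>\<B> \<and> (\<forall>B\<in>\<B>. open_box B \<delta>) \<and>
        real (card \<B>) \<le> C p * scale_count ?n \<delta>"
    proof
      fix p assume "p \<in> P"
      then have "coverable (U p) (C p)" using UC P(1) by blast
      then show "\<exists>\<B>. finite \<B> \<and> U p \<subseteq> \<Union>\<B> \<and> (\<forall>B\<in>\<B>. open_box B \<delta>) \<and>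
          real (card \<B>) \<le> C p * scale_count ?n \<delta>"
        unfolding coverable_def using \<delta> by simp
    qed
    then obtain \<B> where \<B>: "\<And>p. p \<in> P \<Longrightarrow> finite (\<B> p) \<and> U p \<subseteq> \<Union>(\<B> p) \<and>
        (\<forall>B\<in>\<B> p. open_box B \<delta>) \<and> real (card (\<B> p)) \<le> C p * scale_count ?n \<delta>"
      by metis
    have "\<Gamma> \<subseteq> \<Union>(\<Union>p\<in>P. \<B> p)"
    proof
      fix x assume "x \<in> \<Gamma>"
      then obtain p where "p \<in> P" "x \<in> U p" using D(3) P(3) by blast
      then show "x \<in> \<Union>(\<Union>p\<in>P. \<B> p)" using \<B>[of p] by blast
    qed
    moreover have "real (card (\<Union>p\<in>P. \<B> p)) \<le> (\<Sum>p\<in>P. C p) * scale_count ?n \<delta>"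
    proof -
      have "real (card (\<Union>p\<in>P. \<B> p)) \<le> real (\<Sum>p\<in>P. card (\<B> p))"
        by (rule of_nat_mono[OF card_UN_le[OF P(2)]])
      also have "\<dots> = (\<Sum>p\<in>P. real (card (\<B> p)))" by (rule of_nat_sum)
      also have "\<dots> \<le> (\<Sum>p\<in>P. C p * scale_count ?n \<delta>)"
        by (rule sum_mono) (drule \<B>, elim conjE)
      also have "\<dots> = (\<Sum>p\<in>P. C p) * scale_count ?n \<delta>" by (rule sum_distrib_right[symmetric])
      finally show ?thesis .
    qed
    moreover have "finite (\<Union>p\<in>P. \<B> p)" "\<forall>B\<in>(\<Union>p\<in>P. \<B> p). open_box B \<delta>"
    proof -
      show "finite (\<Union>p\<in>P. \<B> p)" by (rule finite_UN_I[OF P(2)]) (drule \<B>, elim conjE)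
      show "\<forall>B\<in>(\<Union>p\<in>P. \<B> p). open_box B \<delta>"
      proof
        fix B assume "B \<in> (\<Union>p\<in>P. \<B> p)"
        then obtain p where "p \<in> P" "B \<in> \<B> p" by (elim UN_E)
        then show "open_box B \<delta>" using \<B>[of p] by simp
      qed
    qed
    ultimately show ?thesis by (intro exI[of _ "\<Union>p\<in>P. \<B> p"] conjI)
  qed
  moreover have "0 < (\<Sum>p\<in>P. C p)"
    using P(1,2) \<open>P \<noteq> {}\<close> UC by (intro sum_pos) (auto simp: coverable_def)
  ultimately show ?thesis using that by blast
qed

section \<open>Covering numbers, profile and prints of a non-degenerate curve\<close>

lemma local_param_mono:
  assumes "local_param k \<Gamma> \<gamma> I" "j \<le> k"
  shows "local_param j \<Gamma> \<gamma> I"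
proof -
  from assms(1) obtain J where "open J" "is_interval J" "I \<subseteq> J" "Ck_on k \<gamma> J"
    unfolding local_param_def by (elim conjE exE)
  then have "\<exists>J. open J \<and> is_interval J \<and> I \<subseteq> J \<and> Ck_on j \<gamma> J"
    using Ck_on_mono[OF _ assms(2)] by (intro exI[of _ J]) simp
  with assms(1) show ?thesis
    unfolding local_param_def by (elim conjE) (intro conjI; assumption)
qed

lemma compact_embedded_curve_mono:
  assumes "compact_embedded_curve k \<Gamma>" "j \<le> k"
  shows "compact_embedded_curve j \<Gamma>"
  unfolding compact_embedded_curve_def
proof (intro conjI ballI)
  show "\<Gamma> \<noteq> {}" "compact \<Gamma>" using assms(1) by (simp_all add: compact_embedded_curve_def)
  fix p assume "p \<in> \<Gamma>"
  then obtain \<gamma> I where "local_param k \<Gamma> \<gamma> I" "p \<in> \<gamma> ` I"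
    using assms(1) unfolding compact_embedded_curve_def by blast
  then show "\<exists>\<gamma> I. local_param j \<Gamma> \<gamma> I \<and> p \<in> \<gamma> ` I"
    using local_param_mono[OF _ assms(2)] by blast
qed

lemma nondegenerate_curve_covering_number_bounds:
  fixes \<Gamma> :: "(real ^ 'n) set"
  assumes "nondegenerate_curve \<Gamma>"
  shows "\<exists>c>0. \<exists>C>0. \<forall>\<delta>\<in>Delta CARD('n).
    c * scale_count CARD('n) \<delta> \<le> real (covering_number \<Gamma> \<delta>) \<and>
    real (covering_number \<Gamma> \<delta>) \<le> C * scale_count CARD('n) \<delta>"
proof -
  let ?n = "CARD('n)"
  obtain c where c: "0 < c" "\<And>\<delta> \<B>. \<delta> \<in> Delta ?n \<Longrightarrow> finite \<B> \<Longrightarrow> \<Gamma> \<subseteq> \<Union>\<B> \<Longrightarrow>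
    (\<And>B. B \<in> \<B> \<Longrightarrow> \<exists>l. open_box B l \<and> (\<forall>j\<in>{1..?n}. l j \<le> \<delta> j)) \<Longrightarrow>
    c * scale_count ?n \<delta> \<le> real (card \<B>)"
    using nondegenerate_curve_covering_lower_bound[OF assms] by metis
  have "compact_embedded_curve ?n \<Gamma>"
    using assms compact_embedded_curve_mono[of "?n + 1" \<Gamma> ?n] unfolding nondegenerate_curve_def by simp
  then obtain C where C: "0 < C" "\<And>\<delta>. \<delta> \<in> Delta ?n \<Longrightarrow> \<exists>\<B>. finite \<B> \<and> \<Gamma> \<subseteq> \<Union>\<B> \<and>
    (\<forall>B\<in>\<B>. open_box B \<delta>) \<and> real (card \<B>) \<le> C * scale_count ?n \<delta>"
    using compact_embedded_curve_covering_upper_bound by metis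
  have "c * scale_count ?n \<delta> \<le> real (covering_number \<Gamma> \<delta>) \<and>
      real (covering_number \<Gamma> \<delta>) \<le> C * scale_count ?n \<delta>" if \<delta>: "\<delta> \<in> Delta ?n" for \<delta>
  proof -
    define admits where "admits m \<longleftrightarrow> (\<exists>\<B>. finite \<B> \<and> card \<B> = m \<and> \<Gamma> \<subseteq> \<Union>\<B> \<and>
        (\<forall>B\<in>\<B>. \<exists>l. open_box B l \<and> (\<forall>i\<in>{1..?n}. l i \<le> \<delta> i)))" for m
    have cn: "covering_number \<Gamma> \<delta> = (LEAST m. admits m)"
      by (simp add: covering_number_def admits_def)
    obtain \<B> where \<B>: "finite \<B>" "\<Gamma> \<subseteq> \<Union>\<B>" "\<forall>B\<in>\<B>. open_box B \<delta>"
      "real (card \<B>) \<le> C * scale_count ?n \<delta>" using C(2)[OF \<delta>] by blast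
    have adm: "admits (card \<B>)" unfolding admits_def using \<B> by blast
    have "covering_number \<Gamma> \<delta> \<le> card \<B>" unfolding cn using adm by (rule Least_le)
    then have "real (covering_number \<Gamma> \<delta>) \<le> C * scale_count ?n \<delta>" using \<B>(4) by linarith
    moreover have "admits (covering_number \<Gamma> \<delta>)" unfolding cn using adm by (rule LeastI)
    then obtain \<B>' where \<B>': "finite \<B>'" "card \<B>' = covering_number \<Gamma> \<delta>" "\<Gamma> \<subseteq> \<Union>\<B>'"
      "\<forall>B\<in>\<B>'. \<exists>l. open_box B l \<and> (\<forall>i\<in>{1..?n}. l i \<le> \<delta> i)"
      unfolding admits_def by (elim exE conjE)
    have "c * scale_count ?n \<delta> \<le> real (covering_number \<Gamma> \<delta>)"
      using c(2)[OF \<delta> \<B>'(1,3)] \<B>'(2,4) by simp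
    ultimately show ?thesis by blast
  qed
  then show ?thesis using c(1) C(1) by (intro exI[of _ c] exI[of _ C] conjI ballI) auto
qed

theorem theorem4p6:
  fixes \<Gamma> :: "(real ^ 'n) set"
  assumes "CARD('n) \<ge> 2"
    and "nondegenerate_curve \<Gamma>"
  shows "uniformly_profile_regular \<Gamma> \<and>
    (\<forall>a\<in>rates CARD('n). profile \<Gamma> a = Max ((\<lambda>i. a i / real i) ` {1..CARD('n)})) \<and>
    lower_print \<Gamma> = {\<alpha> \<in> exponents CARD('n). (\<Sum>i=1..CARD('n). real i * \<alpha> i) \<le> 1} \<and>
    upper_print \<Gamma> =
      {\<alpha> \<in> exponents CARD('n). tail_sum CARD('n) 1 \<alpha> \<le> 1} \<union>
      (\<Union>k\<in>{2..CARD('n)}. {\<alpha> \<in> exponents CARD('n). tail_sum CARD('n) k \<alpha> < 1 / real k})"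
proof -
  obtain c C where cC: "0 < c" "0 < C" "\<forall>\<delta>\<in>Delta CARD('n).
      c * scale_count CARD('n) \<delta> \<le> real (covering_number \<Gamma> \<delta>) \<and>
      real (covering_number \<Gamma> \<delta>) \<le> C * scale_count CARD('n) \<delta>"
    using nondegenerate_curve_covering_number_bounds[OF assms(2)] by (elim exE conjE)
  then have lower: "c * scale_count CARD('n) \<delta> \<le> real (covering_number \<Gamma> \<delta>)"
    and upper: "real (covering_number \<Gamma> \<delta>) \<le> C * scale_count CARD('n) \<delta>"
    if "\<delta> \<in> Delta CARD('n)" for \<delta>
    using that by auto
  show ?thesis
  proof (intro conjI ballI)
    show "uniformly_profile_regular \<Gamma>"
      by (rule uniformly_profile_regular_of_scale_count_bounds(1)[OF cC(1) _ cC(2)])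
        (erule lower upper)+
    show "profile \<Gamma> a = Max ((\<lambda>i. a i / real i) ` {1..CARD('n)})" if "a \<in> rates CARD('n)" for a
      by (rule uniformly_profile_regular_of_scale_count_bounds(2)[OF cC(1) _ cC(2) _ that])
        (erule lower upper)+
  qed (rule lower_print_of_scale_count_bounds[OF cC(1) _ cC(2)]
      upper_print_of_scale_count_bounds[OF cC(1) _ cC(2)]; erule lower upper)+
qed

end
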